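(* Let $A$ be a Johnson pseudo-contractible Banach algebra. Then $A$ has no non-zero closed nilpotent ideal which is complemented in $A$.
   Context: Ideals are two-sided. An ideal $N$ is nilpotent if there is $n\in\mathbb{N}$ such that every product of $n$ elements of $N$ is zero. A subspace $E$ of a normed space $X$ is complemented in $X$ if there is a bounded operator $P:X\to E$ with $P(x)=x$ for every $x\in E$. For a Banach algebra $A$, let $A\otimes_p A$ be the (completed) projective tensor product, a Banach $A$-bimodule with actions determined by $a\cdot(b\otimes c)=ab\otimes c$ and $(b\otimes c)\cdot a=b\otimes ca$, and let $\pi_A:A\otimes_p A\to A$ be the bounded linear map determined by $\pi_A(a\otimes b)=ab$. The biduals $A^{**}$ and $(A\otimes_p A)^{**}$ carry the induced bidual $A$-bimodule structures, and $A$ is regarded as canonically embedded in $A^{**}$. $A$ is called Johnson pseudo-contractible if there is a (not necessarily bounded) net $(m_\alpha)$ in $(A\otimes_p A)^{**}$ such that $a\cdot m_\alpha=m_\alpha\cdot a$ for all $\alpha$ and $\pi_A^{**}(m_\alpha)a-a\to 0$ in norm, for every $a\in A$. *)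

theory Defs
  imports "HOL-Analysis.Analysis"
begin

section \<open>Banach algebras over \<open>\<real>\<close> or \<open>\<complex>\<close>\<close>

text \<open>
  The scalar type \<open>'k\<close> of class \<open>{real_normed_field, euclidean_space}\<close> stands for the real or the
  complex numbers: it is a finite-dimensional field extension of the reals with multiplicative norm.
  No unit is assumed.
\<close>

locale banach_algebra = vector_space smul
  for smul :: "'k::{real_normed_field,euclidean_space} \<Rightarrow> 'a::{real_normed_algebra,banach} \<Rightarrow> 'a" +
  assumes scale_of_real: "smul (of_real r) x = r *\<^sub>R x"
    and norm_scale: "norm (smul c x) = norm c * norm x"
    and scale_mult_left: "smul c x * y = smul c (x * y)"
    and scale_mult_right: "x * smul c y = smul c (x * y)"


section \<open>Normed spaces with explicit carrier\<close>

text \<open>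
  The projective tensor product depends on the scalar multiplication, which is a term, and hence
  cannot be a type of its own.
\<close>

record ('k, 'v) nspace =
  vcarrier :: "'v set"
  vadd :: "'v \<Rightarrow> 'v \<Rightarrow> 'v"
  vscale :: "'k \<Rightarrow> 'v \<Rightarrow> 'v"
  vnorm :: "'v \<Rightarrow> real"

definition vdiff :: "('k::ring_1, 'v) nspace \<Rightarrow> 'v \<Rightarrow> 'v \<Rightarrow> 'v" where
  "vdiff X x y = vadd X x (vscale X (- 1) y)"

definition scalars :: "('k::real_normed_field, 'k) nspace" where
  "scalars = \<lparr>vcarrier = UNIV, vadd = (+), vscale = (*), vnorm = norm\<rparr>"

definition alg_space :: "('k \<Rightarrow> 'a \<Rightarrow> 'a) \<Rightarrow> ('k, 'a::real_normed_algebra) nspace" where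
  "alg_space smul = \<lparr>vcarrier = UNIV, vadd = (+), vscale = smul, vnorm = norm\<rparr>"

text \<open>
  Operators are extensional, i.e. \<open>undefined\<close> outside the carrier, so that an operator is
  determined by its values on the carrier.
\<close>

definition bounded_ops :: "('k, 'v) nspace \<Rightarrow> ('k, 'w) nspace \<Rightarrow> ('v \<Rightarrow> 'w) set" where
  "bounded_ops X Y = {f \<in> vcarrier X \<rightarrow>\<^sub>E vcarrier Y.
     (\<forall>x\<in>vcarrier X. \<forall>y\<in>vcarrier X. f (vadd X x y) = vadd Y (f x) (f y)) \<and>
     (\<forall>c. \<forall>x\<in>vcarrier X. f (vscale X c x) = vscale Y c (f x)) \<and>
     (\<exists>B. \<forall>x\<in>vcarrier X. vnorm Y (f x) \<le> B * vnorm X x)}"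

definition dual :: "('k::real_normed_field, 'v) nspace \<Rightarrow> ('k, 'v \<Rightarrow> 'k) nspace" where
  "dual X = \<lparr>vcarrier = bounded_ops X scalars,
     vadd = (\<lambda>f g. \<lambda>x\<in>vcarrier X. f x + g x),
     vscale = (\<lambda>c f. \<lambda>x\<in>vcarrier X. c * f x),
     vnorm = (\<lambda>f. Sup {norm (f x) |x. x \<in> vcarrier X \<and> vnorm X x \<le> 1})\<rparr>"

abbreviation bidual :: "('k::real_normed_field, 'v) nspace \<Rightarrow> ('k, ('v \<Rightarrow> 'k) \<Rightarrow> 'k) nspace" where
  "bidual X \<equiv> dual (dual X)"

definition canon :: "('k::real_normed_field, 'v) nspace \<Rightarrow> 'v \<Rightarrow> ('v \<Rightarrow> 'k) \<Rightarrow> 'k" where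
  "canon X x = (\<lambda>f\<in>vcarrier (dual X). f x)"

definition adjoint_op ::
  "('k::real_normed_field, 'v) nspace \<Rightarrow> ('k, 'w) nspace \<Rightarrow> ('v \<Rightarrow> 'w) \<Rightarrow> ('w \<Rightarrow> 'k) \<Rightarrow> 'v \<Rightarrow> 'k" where
  "adjoint_op X Y T = (\<lambda>g\<in>vcarrier (dual Y). \<lambda>x\<in>vcarrier X. g (T x))"

definition biadjoint_op ::
  "('k::real_normed_field, 'v) nspace \<Rightarrow> ('k, 'w) nspace \<Rightarrow> ('v \<Rightarrow> 'w) \<Rightarrow>
    (('v \<Rightarrow> 'k) \<Rightarrow> 'k) \<Rightarrow> ('w \<Rightarrow> 'k) \<Rightarrow> 'k" where
  "biadjoint_op X Y T = adjoint_op (dual Y) (dual X) (adjoint_op X Y T)"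


section \<open>Completion of a normed space\<close>

definition cauchy_seqs :: "('k::ring_1, 'v) nspace \<Rightarrow> (nat \<Rightarrow> 'v) set" where
  "cauchy_seqs X = {s. (\<forall>n. s n \<in> vcarrier X) \<and>
     (\<forall>e>0. \<exists>M. \<forall>m\<ge>M. \<forall>n\<ge>M. vnorm X (vdiff X (s m) (s n)) < e)}"

definition null_rel :: "('k::ring_1, 'v) nspace \<Rightarrow> ((nat \<Rightarrow> 'v) \<times> (nat \<Rightarrow> 'v)) set" where
  "null_rel X = {(s, t). s \<in> cauchy_seqs X \<and> t \<in> cauchy_seqs X \<and>
     (\<lambda>n. vnorm X (vdiff X (s n) (t n))) \<longlonglongrightarrow> 0}"

definition completion :: "('k::ring_1, 'v) nspace \<Rightarrow> ('k, (nat \<Rightarrow> 'v) set) nspace" where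
  "completion X = \<lparr>vcarrier = cauchy_seqs X // null_rel X,
     vadd = (\<lambda>P Q. \<Union>s\<in>P. \<Union>t\<in>Q. null_rel X `` {\<lambda>n. vadd X (s n) (t n)}),
     vscale = (\<lambda>c P. \<Union>s\<in>P. null_rel X `` {\<lambda>n. vscale X c (s n)}),
     vnorm = (\<lambda>P. the_elem (\<Union>s\<in>P. {lim (\<lambda>n. vnorm X (s n))}))\<rparr>"

definition completion_embed :: "('k::ring_1, 'v) nspace \<Rightarrow> 'v \<Rightarrow> (nat \<Rightarrow> 'v) set" where
  "completion_embed X x = null_rel X `` {\<lambda>_. x}"


section \<open>The projective tensor product \<open>A \<otimes>\<^sub>p A\<close>\<close>

definition bilinear_form :: "('k::field \<Rightarrow> 'a::ab_group_add \<Rightarrow> 'a) \<Rightarrow> ('a \<Rightarrow> 'a \<Rightarrow> 'k) \<Rightarrow> bool" where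
  "bilinear_form smul \<phi> \<longleftrightarrow>
     (\<forall>b. Vector_Spaces.linear smul (*) (\<lambda>a. \<phi> a b)) \<and>
     (\<forall>a. Vector_Spaces.linear smul (*) (\<lambda>b. \<phi> a b))"

text \<open>
  The algebraic tensor product is realised in the usual way inside the algebraic dual of the space of
  all bilinear forms, \<open>a \<otimes> b\<close> being evaluation at \<open>(a, b)\<close>; \<open>tensor_sum\<close> is the finite sum
  \<open>a\<^sub>1 \<otimes> b\<^sub>1 + \<dots> + a\<^sub>n \<otimes> b\<^sub>n\<close>. Every tensor has this form. The value \<open>0\<close> off the bilinear forms is junk.
\<close>

definition tensor_sum ::
  "('k::field \<Rightarrow> 'a::ab_group_add \<Rightarrow> 'a) \<Rightarrow> ('a \<times> 'a) list \<Rightarrow> ('a \<Rightarrow> 'a \<Rightarrow> 'k) \<Rightarrow> 'k" where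
  "tensor_sum smul xs = (\<lambda>\<phi>. if bilinear_form smul \<phi> then \<Sum>(a, b)\<leftarrow>xs. \<phi> a b else 0)"

definition projective_norm ::
  "('k::field \<Rightarrow> 'a::real_normed_vector \<Rightarrow> 'a) \<Rightarrow> (('a \<Rightarrow> 'a \<Rightarrow> 'k) \<Rightarrow> 'k) \<Rightarrow> real" where
  "projective_norm smul u = Inf {\<Sum>(a, b)\<leftarrow>xs. norm a * norm b |xs. u = tensor_sum smul xs}"

definition alg_tensor ::
  "('k::field \<Rightarrow> 'a::real_normed_vector \<Rightarrow> 'a) \<Rightarrow> ('k, ('a \<Rightarrow> 'a \<Rightarrow> 'k) \<Rightarrow> 'k) nspace" where
  "alg_tensor smul = \<lparr>vcarrier = range (tensor_sum smul),
     vadd = (\<lambda>u v \<phi>. u \<phi> + v \<phi>),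
     vscale = (\<lambda>c u \<phi>. c * u \<phi>),
     vnorm = projective_norm smul\<rparr>"

type_synonym ('k, 'a) ptensor = "(nat \<Rightarrow> ('a \<Rightarrow> 'a \<Rightarrow> 'k) \<Rightarrow> 'k) set"

definition proj_tensor ::
  "('k::field \<Rightarrow> 'a::real_normed_vector \<Rightarrow> 'a) \<Rightarrow> ('k, ('k, 'a) ptensor) nspace" where
  "proj_tensor smul = completion (alg_tensor smul)"

definition tens ::
  "('k::field \<Rightarrow> 'a::real_normed_vector \<Rightarrow> 'a) \<Rightarrow> 'a \<Rightarrow> 'a \<Rightarrow> ('k, 'a) ptensor" where
  "tens smul a b = completion_embed (alg_tensor smul) (tensor_sum smul [(a, b)])"

text \<open>The bounded operator on \<open>A \<otimes>\<^sub>p A\<close> determined by \<open>a \<otimes> b \<mapsto> h a b\<close>, for bounded bilinear \<open>h\<close>.\<close>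

definition tensor_lift ::
  "('k::field \<Rightarrow> 'a::real_normed_vector \<Rightarrow> 'a) \<Rightarrow> ('k, 'w) nspace \<Rightarrow> ('a \<Rightarrow> 'a \<Rightarrow> 'w) \<Rightarrow>
    ('k, 'a) ptensor \<Rightarrow> 'w" where
  "tensor_lift smul Y h =
     (THE T. T \<in> bounded_ops (proj_tensor smul) Y \<and> (\<forall>a b. T (tens smul a b) = h a b))"

definition tensor_lact ::
  "('k::field \<Rightarrow> 'a::real_normed_algebra \<Rightarrow> 'a) \<Rightarrow> 'a \<Rightarrow> ('k, 'a) ptensor \<Rightarrow> ('k, 'a) ptensor" where
  "tensor_lact smul a = tensor_lift smul (proj_tensor smul) (\<lambda>b c. tens smul (a * b) c)"

definition tensor_ract ::
  "('k::field \<Rightarrow> 'a::real_normed_algebra \<Rightarrow> 'a) \<Rightarrow> 'a \<Rightarrow> ('k, 'a) ptensor \<Rightarrow> ('k, 'a) ptensor" where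
  "tensor_ract smul a = tensor_lift smul (proj_tensor smul) (\<lambda>b c. tens smul b (c * a))"

definition product_map ::
  "('k::field \<Rightarrow> 'a::real_normed_algebra \<Rightarrow> 'a) \<Rightarrow> ('k, 'a) ptensor \<Rightarrow> 'a" where
  "product_map smul = tensor_lift smul (alg_space smul) (*)"


section \<open>Johnson pseudo-contractibility\<close>

text \<open>
  On the dual of a bimodule \<open>X\<close> the actions are \<open>(f \<cdot> a) x = f (a \<cdot> x)\<close> and \<open>(a \<cdot> f) x = f (x \<cdot> a)\<close>;
  hence \<open>(a \<cdot> m) f = m (f \<cdot> a)\<close> and \<open>(m \<cdot> a) f = m (a \<cdot> f)\<close> on the bidual, i.e. the action of \<open>a\<close> on
  \<open>X\<^sup>*\<^sup>*\<close> from either side is the second adjoint of its action on \<open>X\<close> from the same side.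
\<close>

definition bidual_tensor_lact where
  "bidual_tensor_lact smul a =
     biadjoint_op (proj_tensor smul) (proj_tensor smul) (tensor_lact smul a)"

definition bidual_tensor_ract where
  "bidual_tensor_ract smul a =
     biadjoint_op (proj_tensor smul) (proj_tensor smul) (tensor_ract smul a)"

definition bidual_alg_ract where
  "bidual_alg_ract smul a = biadjoint_op (alg_space smul) (alg_space smul) (\<lambda>x. x * a)"

definition directed_set :: "'i set \<Rightarrow> ('i \<Rightarrow> 'i \<Rightarrow> bool) \<Rightarrow> bool" where
  "directed_set I le \<longleftrightarrow> I \<noteq> {} \<and> (\<forall>i\<in>I. le i i) \<and>
     (\<forall>i\<in>I. \<forall>j\<in>I. \<forall>k\<in>I. le i j \<longrightarrow> le j k \<longrightarrow> le i k) \<and>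
     (\<forall>i\<in>I. \<forall>j\<in>I. \<exists>k\<in>I. le i k \<and> le j k)"

definition tail_filter :: "'i set \<Rightarrow> ('i \<Rightarrow> 'i \<Rightarrow> bool) \<Rightarrow> 'i filter" where
  "tail_filter I le = (INF i\<in>I. principal {j \<in> I. le i j})"

text \<open>
  A definition cannot quantify over types, so the type \<open>'i\<close> of net indices is a parameter. A theorem
  assuming this predicate for an arbitrary \<open>'i\<close> covers nets over all directed sets.
\<close>

definition johnson_pseudo_contractible ::
  "'i itself \<Rightarrow> ('k::{real_normed_field,euclidean_space} \<Rightarrow> 'a::{real_normed_algebra,banach} \<Rightarrow> 'a)
    \<Rightarrow> bool" where
  "johnson_pseudo_contractible (_ :: 'i itself) smul \<longleftrightarrow>
     (\<exists>(I :: 'i set) le m. directed_set I le \<and>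
        (\<forall>\<alpha>\<in>I. m \<alpha> \<in> vcarrier (bidual (proj_tensor smul))) \<and>
        (\<forall>a. \<forall>\<alpha>\<in>I. bidual_tensor_lact smul a (m \<alpha>) = bidual_tensor_ract smul a (m \<alpha>)) \<and>
        (\<forall>a. ((\<lambda>\<alpha>. vnorm (bidual (alg_space smul))
                (vdiff (bidual (alg_space smul))
                  (bidual_alg_ract smul a
                    (biadjoint_op (proj_tensor smul) (alg_space smul) (product_map smul) (m \<alpha>)))
                  (canon (alg_space smul) a)))
              \<longlongrightarrow> 0) (tail_filter I le)))"


section \<open>Ideals\<close>

definition two_sided_ideal :: "('k::field \<Rightarrow> 'a::real_normed_algebra \<Rightarrow> 'a) \<Rightarrow> 'a set \<Rightarrow> bool" where
  "two_sided_ideal smul N \<longleftrightarrow> module.subspace smul N \<and> (\<forall>a. \<forall>x\<in>N. a * x \<in> N \<and> x * a \<in> N)"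

text \<open>Products of length \<open>0\<close> are excluded since \<open>A\<close> need not have a unit.\<close>

definition nilpotent_ideal :: "'a::real_normed_algebra set \<Rightarrow> bool" where
  "nilpotent_ideal N \<longleftrightarrow>
     (\<exists>n\<ge>1. \<forall>x xs. set (x # xs) \<subseteq> N \<and> length (x # xs) = n \<longrightarrow> foldl (*) x xs = 0)"

definition complemented :: "('k, 'v) nspace \<Rightarrow> 'v set \<Rightarrow> bool" where
  "complemented X E \<longleftrightarrow> (\<exists>P\<in>bounded_ops X (X\<lparr>vcarrier := E\<rparr>). \<forall>x\<in>E. P x = x)"

end

theory Submission
  imports Defs
begin

text \<open>
  Let \<open>N\<close> be an ideal with a bounded projection \<open>P : A \<rightarrow> N\<close>. An element \<open>m\<close> of \<open>(A \<otimes>\<^sub>p A)\<^sup>*\<^sup>*\<close> with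
  \<open>a \<cdot> m = m \<cdot> a\<close> averages \<open>P\<close> to the right module map \<open>x \<mapsto> \<Sum> P (x b) c\<close>, where \<open>m\<close> is thought of as
  \<open>\<Sum> b \<otimes> c\<close>; it maps \<open>A N\<close> into \<open>N N\<close> and is close to the identity on \<open>N\<close>. So a bounded functional
  that vanishes on \<open>N N\<close> vanishes on \<open>A N\<close>, and then on \<open>N\<close>, since \<open>\<Sum> b c x\<close> is close to \<open>x\<close>.
  Applying this to functionals \<open>z \<mapsto> f (w * z)\<close> with \<open>w\<close> a product of elements of \<open>N\<close>, the
  Hahn-Banach theorem lowers the nilpotency order of \<open>N\<close> step by step to 1.
\<close>

section \<open>Separation of points by bounded functionals\<close>

text \<open>The average \<open>x \<mapsto> \<Sum> P (x b) c\<close> takes values in the bidual only,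
  because \<open>m\<close> lives there, so everything is tested against one bounded functional f at
  a time. Each \<open>m \<alpha>\<close> commutes exactly with the algebra, so the values to be
  killed are 0 at every index; the limit enters only for fixed f and a, which makes an unbounded net
  harmless. The projection is there for one reason: for y in N the element \<open>a * y * b\<close>
  is fixed by P, and after y has moved to the other leg the factor \<open>P (a * b)\<close> still
  lies in N, where \<open>a * b\<close> itself need not.

  Below this lies the construction of the tensor product. \<open>tensor_lift\<close> is a definite
  description, so the actions, the product map and all forms have meaning only after an operator
  with the prescribed values on elementary tensors is built and shown to be unique. Uniqueness is
  density. Existence requires well-definedness on formal sums, and as tensors are known through
  scalar-valued bilinear forms only, the separation of points is used there as well.\<close>

definition sublinear :: "('a::real_vector \<Rightarrow> real) \<Rightarrow> bool" where
  "sublinear p \<longleftrightarrow> (\<forall>x y. p (x + y) \<le> p x + p y) \<and> (\<forall>c\<ge>0. \<forall>x. p (c *\<^sub>R x) = c * p x)"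

lemma sublinear_add: "sublinear p \<Longrightarrow> p (x + y) \<le> p x + p y"
  and sublinear_scaleR: "sublinear p \<Longrightarrow> c \<ge> 0 \<Longrightarrow> p (c *\<^sub>R x) = c * p x"
  by (auto simp: sublinear_def)

lemma sublinear_zero: "sublinear p \<Longrightarrow> p 0 = 0"
  using sublinear_scaleR[of p 0 0] by simp

lemma sublinear_minus: "sublinear p \<Longrightarrow> - p (- x) \<le> p x"
  using sublinear_add[of p x "- x"] by (simp add: sublinear_zero)

lemma sublinear_norm: "sublinear norm"
  by (simp add: sublinear_def norm_triangle_ineq)

text \<open>Built so that its value at \<open>- y\<close> is at most \<open>- p y\<close>: a linear
  functional below it must then take the value \<open>p y\<close> at y. It is the largest sublinear
  functional below p with this property.\<close>

definition sublinear_shift :: "('a::real_vector \<Rightarrow> real) \<Rightarrow> 'a \<Rightarrow> 'a \<Rightarrow> real" where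
  "sublinear_shift p y x = (INF t\<in>{0..}. p (x + t *\<^sub>R y) - t * p y)"

text \<open>Since \<open>t * p y = p (t *\<^sub>R y)\<close>, subadditivity bounds every term from
  below by \<open>- p (- x)\<close>, so the infimum in \<open>sublinear_shift\<close> is a genuine
  one.\<close>

lemma sublinear_shift_bdd_below:
  assumes "sublinear p"
  shows "bdd_below ((\<lambda>t. p (x + t *\<^sub>R y) - t * p y) ` {0..})"
proof (rule bdd_belowI2)
  fix t :: real assume "t \<in> {0..}"
  then show "- p (- x) \<le> p (x + t *\<^sub>R y) - t * p y"
    using sublinear_add[OF assms, of "x + t *\<^sub>R y" "- x"] sublinear_scaleR[OF assms, of t y] by simp
qed

lemma sublinear_shift_le:
  assumes "sublinear p" "t \<ge> 0"
  shows "sublinear_shift p y x \<le> p (x + t *\<^sub>R y) - t * p y"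
  unfolding sublinear_shift_def
  using assms by (intro cINF_lower sublinear_shift_bdd_below) auto

lemma sublinear_shift_greatest:
  assumes "\<And>t. t \<ge> 0 \<Longrightarrow> c \<le> p (x + t *\<^sub>R y) - t * p y"
  shows "c \<le> sublinear_shift p y x"
  unfolding sublinear_shift_def
  using assms by (intro cINF_greatest) auto

lemma sublinear_sublinear_shift:
  fixes p :: "'a::real_vector \<Rightarrow> real"
  assumes p: "sublinear p"
  shows "sublinear (sublinear_shift p y)"
proof -
  let ?q = "sublinear_shift p y"
  have add: "?q (x + x') \<le> ?q x + ?q x'" for x x'
  proof -
    \<comment> \<open>The two infima are taken one after the other; s for x and t for x' combine to
      the parameter s + t for the sum.\<close>
    have "?q (x + x') - (p (x + s *\<^sub>R y) - s * p y) \<le> ?q x'" if s: "s \<ge> 0" for s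
    proof (rule sublinear_shift_greatest)
      fix t :: real assume t: "t \<ge> 0"
      have "?q (x + x') \<le> p (x + x' + (s + t) *\<^sub>R y) - (s + t) * p y"
        using s t by (intro sublinear_shift_le p) auto
      also have "x + x' + (s + t) *\<^sub>R y = (x + s *\<^sub>R y) + (x' + t *\<^sub>R y)"
        by (simp add: algebra_simps)
      finally show "?q (x + x') - (p (x + s *\<^sub>R y) - s * p y) \<le> p (x' + t *\<^sub>R y) - t * p y"
        using sublinear_add[OF p, of "x + s *\<^sub>R y" "x' + t *\<^sub>R y"] by (simp add: algebra_simps)
    qed
    then have "?q (x + x') - ?q x' \<le> ?q x"
      by (intro sublinear_shift_greatest) (simp add: algebra_simps)
    then show ?thesis by simp
  qed
  \<comment> \<open>Substitution of c * t for t. The reverse inequality is this one for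
    \<open>inverse c\<close>.\<close>
  have scale_le: "?q (c *\<^sub>R x) \<le> c * ?q x" if c: "c > 0" for c x
  proof -
    have "?q (c *\<^sub>R x) / c \<le> ?q x"
    proof (rule sublinear_shift_greatest)
      fix t :: real assume t: "t \<ge> 0"
      have "?q (c *\<^sub>R x) \<le> p (c *\<^sub>R x + (c * t) *\<^sub>R y) - (c * t) * p y"
        using c t by (intro sublinear_shift_le p) auto
      also have "c *\<^sub>R x + (c * t) *\<^sub>R y = c *\<^sub>R (x + t *\<^sub>R y)"
        by (simp add: algebra_simps)
      also have "p \<dots> = c * p (x + t *\<^sub>R y)"
        using c by (simp add: sublinear_scaleR[OF p])
      finally show "?q (c *\<^sub>R x) / c \<le> p (x + t *\<^sub>R y) - t * p y"
        using c by (simp add: field_simps)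
    qed
    then show ?thesis using c by (simp add: field_simps)
  qed
  have zero: "?q 0 = 0"
    unfolding sublinear_shift_def using sublinear_scaleR[OF p]
    by (simp add: cong: INF_cong_simp)
  have "?q (c *\<^sub>R x) = c * ?q x" if "c \<ge> 0" for c x
  proof (cases "c = 0")
    case False
    then have c: "c > 0" using that by simp
    have "?q (inverse c *\<^sub>R c *\<^sub>R x) \<le> inverse c * ?q (c *\<^sub>R x)"
      using c by (intro scale_le) auto
    then have "c * ?q x \<le> ?q (c *\<^sub>R x)" using c by (simp add: field_simps)
    then show ?thesis using scale_le[OF c, of x] by simp
  qed (simp add: zero)
  with add show ?thesis by (simp add: sublinear_def)
qed

lemma sublinear_shift_le_self:
  "sublinear p \<Longrightarrow> sublinear_shift p y x \<le> p x"
  using sublinear_shift_le[of p 0 y x] by simp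

lemma sublinear_shift_minus:
  "sublinear p \<Longrightarrow> sublinear_shift p y (- y) \<le> - p y"
  using sublinear_shift_le[of p 1 y "- y"] by (simp add: sublinear_zero)

text \<open>A minimal sublinear functional is unchanged by every shift, hence odd, hence linear.\<close>

lemma linear_if_minimal_sublinear:
  assumes p: "sublinear p" and min: "\<And>q. sublinear q \<Longrightarrow> q \<le> p \<Longrightarrow> q = p"
  shows "linear p"
proof -
  have odd: "p (- y) = - p y" for y
  proof -
    have "sublinear_shift p y = p"
      by (intro min sublinear_sublinear_shift p le_funI sublinear_shift_le_self)
    then have "p (- y) \<le> - p y"
      using sublinear_shift_minus[OF p, of y] by simp
    then show ?thesis using sublinear_minus[OF p, of y] by simp
  qed
  show ?thesis
  proof (rule linearI)
    fix x y
    show "p (x + y) = p x + p y"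
      using sublinear_add[OF p, of x y] sublinear_add[OF p, of "x + y" "- y"] odd[of y] by simp
  next
    fix c x
    show "p (c *\<^sub>R x) = c *\<^sub>R p x"
      using sublinear_scaleR[OF p, of c x] sublinear_scaleR[OF p, of "- c" x] odd[of "c *\<^sub>R x"]
      by (cases "c \<ge> 0") auto
  qed
qed

text \<open>Zorn's lemma yields a minimal sublinear functional below p, and minimal ones are linear.
  The order is reversed because \<open>predicate_Zorn\<close> produces maximal elements; a chain is
  bounded by its pointwise infimum, which is finite since every sublinear q \<le> p satisfies
  \<open>q x \<ge> - p (- x)\<close>.\<close>

lemma sublinear_dominates_linear:
  fixes p :: "'a::real_vector \<Rightarrow> real"
  assumes p: "sublinear p"
  shows "\<exists>g. linear g \<and> g \<le> p"
proof -
  define S where "S = {q. sublinear q \<and> q \<le> p}"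
  have "\<exists>m\<in>S. \<forall>q\<in>S. q \<le> m \<longrightarrow> q = m"
  proof (rule predicate_Zorn)
    show "partial_order_on S (relation_of (\<lambda>a b. b \<le> a) S)"
      by (rule partial_order_on_relation_ofI) auto
  next
    fix C assume "C \<in> Chains (relation_of (\<lambda>a b. b \<le> a) S)"
    then have C: "C \<subseteq> S" and chain: "\<And>q r. q \<in> C \<Longrightarrow> r \<in> C \<Longrightarrow> q \<le> r \<or> r \<le> q"
      by (auto simp: Chains_def relation_of_def)
    show "\<exists>u\<in>S. \<forall>a\<in>C. u \<le> a"
    proof (cases "C = {}")
      case True
      then show ?thesis using p by (auto simp: S_def)
    next
      case False
      define u where "u x = (INF q\<in>C. q x)" for x
      have sub: "sublinear q" and le: "q x \<le> p x" if "q \<in> C" for q x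
        using C that by (auto simp: S_def le_fun_def)
      have bdd: "bdd_below ((\<lambda>q. q x) ` C)" for x
      proof (rule bdd_belowI2)
        fix q assume "q \<in> C"
        then show "- p (- x) \<le> q x"
          using sublinear_minus[OF sub[of q], of x] le[of q "- x"] by simp
      qed
      have lower: "u x \<le> q x" if "q \<in> C" for q x
        unfolding u_def using that by (intro cINF_lower bdd)
      have greatest: "c \<le> u x" if "\<And>q. q \<in> C \<Longrightarrow> c \<le> q x" for c x
        unfolding u_def using that False by (intro cINF_greatest)
      have "u (x + y) \<le> u x + u y" for x y
      proof -
        have "u (x + y) - q x \<le> u y" if q: "q \<in> C" for q
        proof (rule greatest)
          fix r assume r: "r \<in> C"
          \<comment> \<open>The smaller of the two chain members is a single sublinear functional
            below both q and r.\<close>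
          obtain s where s: "s \<in> C" "s \<le> q" "s \<le> r"
            using chain[OF q r] q r by auto
          have "u (x + y) \<le> s (x + y)" by (rule lower[OF s(1)])
          also have "\<dots> \<le> s x + s y" by (rule sublinear_add[OF sub[OF s(1)]])
          also have "\<dots> \<le> q x + r y" using s by (intro add_mono) (auto simp: le_fun_def)
          finally show "u (x + y) - q x \<le> r y" by simp
        qed
        then have "u (x + y) - u y \<le> u x"
          by (intro greatest) (simp add: algebra_simps)
        then show ?thesis by simp
      qed
      moreover have "u (c *\<^sub>R x) = c * u x" if "c \<ge> 0" for c x
      proof (cases "c = 0")
        case True
        have "(\<lambda>q. q 0) ` C = {0}"
          using False sublinear_zero[OF sub] by force
        then have "u 0 = 0" by (simp add: u_def)
        then show ?thesis using True by simp
      next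
        case False
        then have c: "c > 0" using that by simp
        show ?thesis
        proof (rule antisym)
          have "u (c *\<^sub>R x) / c \<le> u x"
            using lower[of _ "c *\<^sub>R x"] c sublinear_scaleR[OF sub]
            by (intro greatest) (fastforce simp: field_simps)
          then show "u (c *\<^sub>R x) \<le> c * u x" using c by (simp add: field_simps)
          show "c * u x \<le> u (c *\<^sub>R x)"
            using lower[of _ x] c by (intro greatest) (simp add: sublinear_scaleR[OF sub])
        qed
      qed
      ultimately have "sublinear u" by (simp add: sublinear_def)
      moreover have "u \<le> p"
        using False lower le by (meson all_not_in_conv le_funI order_trans)
      ultimately show ?thesis
        using lower by (intro bexI[of _ u]) (auto simp: S_def le_fun_def)
    qed
  qed
  then obtain m where "m \<in> S" and min: "\<And>q. q \<in> S \<Longrightarrow> q \<le> m \<Longrightarrow> q = m" by blast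
  then have m: "sublinear m" "m \<le> p" by (auto simp: S_def)
  have "linear m"
    using m min by (intro linear_if_minimal_sublinear) (auto simp: S_def)
  with m show ?thesis by blast
qed

text \<open>Below the shifted norm, linearity turns the bound \<open>g (- v) \<le> - norm v\<close>
  into \<open>g v \<ge> norm v > 0\<close>, and the bound by the norm itself gives
  continuity.\<close>

lemma real_separating_functional:
  fixes v :: "'a::real_normed_vector"
  assumes "v \<noteq> 0"
  shows "\<exists>g :: 'a \<Rightarrow> real. bounded_linear g \<and> g v \<noteq> 0"
proof -
  obtain g where g: "linear g" "g \<le> sublinear_shift norm v"
    using sublinear_dominates_linear[OF sublinear_sublinear_shift[OF sublinear_norm]] by blast
  have le: "g x \<le> norm x" for x
    using g(2) sublinear_shift_le_self[OF sublinear_norm, of v x] by (meson le_funD order_trans)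
  have "\<bar>g x\<bar> \<le> norm x" for x
    using le[of x] le[of "- x"] linear_neg[OF g(1), of x] by simp
  then have "bounded_linear g"
    using g(1) by (intro bounded_linear_intro[where K = 1]) (auto simp: linear_add linear_scale)
  moreover have "g (- v) \<le> - norm v"
    using g(2) sublinear_shift_minus[OF sublinear_norm, of v] by (meson le_funD order_trans)
  then have "g v \<noteq> 0"
    using assms linear_neg[OF g(1), of v] by auto
  ultimately show ?thesis by blast
qed

context banach_algebra begin

text \<open>
  A real functional \<open>g\<close> is turned into a \<open>'k\<close>-linear one as follows: the form \<open>(b, d) \<mapsto> (b * d) \<bullet> 1\<close>
  on \<open>'k\<close> is nondegenerate, so there is a unique \<open>f x\<close> with \<open>g (smul b x) = (b * f x) \<bullet> 1\<close> for all \<open>b\<close>.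
\<close>

lemma separating_functional:
  assumes "v \<noteq> 0"
  shows "\<exists>f. Vector_Spaces.linear smul (*) f \<and> (\<exists>B. \<forall>x. norm (f x) \<le> B * norm x) \<and> f v \<noteq> 0"
proof -
  obtain g :: "'a \<Rightarrow> real" where g: "bounded_linear g" "g v \<noteq> 0"
    using real_separating_functional[OF assms] by blast
  interpret g: bounded_linear g by (rule g(1))
  have scaleR: "smul (r *\<^sub>R b) x = r *\<^sub>R smul b x" for r b x
    by (metis scaleR_conv_of_real scale_scale scale_of_real)
  \<comment> \<open>\<open>L d\<close> is the Riesz representative of the real functional
    \<open>b \<mapsto> (b * d) \<bullet> 1\<close>. Nondegeneracy of the form is injectivity of
    \<open>L\<close>, which in finite dimension provides the inverse \<open>M\<close>.\<close>
  define L :: "'k \<Rightarrow> 'k" where "L d = (\<Sum>b\<in>Basis. ((b * d) \<bullet> 1) *\<^sub>R b)" for d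
  have L_inner: "L d \<bullet> b = (b * d) \<bullet> 1" if "b \<in> Basis" for d b
    using that by (simp add: L_def inner_sum_left inner_Basis if_distrib cong: if_cong)
  have linL: "linear L"
  proof (rule linearI)
    show "L (d + d') = L d + L d'" for d d'
      by (simp add: L_def distrib_left inner_add_left scaleR_add_left sum.distrib)
    show "L (r *\<^sub>R d) = r *\<^sub>R L d" for r d
      by (simp add: L_def scaleR_sum_right)
  qed
  have expand: "(c * d) \<bullet> 1 = (\<Sum>b\<in>Basis. (c \<bullet> b) * ((b * d) \<bullet> 1))" for c d :: 'k
  proof -
    have "c * d = (\<Sum>b\<in>Basis. (c \<bullet> b) *\<^sub>R b) * d" by (simp add: euclidean_representation)
    then show ?thesis by (simp add: sum_distrib_right inner_sum_left)
  qed
  have injL: "d = d'" if "L d = L d'" for d d'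
  proof (rule ccontr)
    assume "d \<noteq> d'"
    have "(b * (d - d')) \<bullet> 1 = 0" if "b \<in> Basis" for b
      using L_inner[OF that, of d] L_inner[OF that, of d'] \<open>L d = L d'\<close>
      by (simp add: right_diff_distrib inner_diff_left)
    \<comment> \<open>By \<open>expand\<close> the vanishing extends from the basis to all factors;
      the inverse as factor gives 1 \<bullet> 1 = 0.\<close>
    then have "(inverse (d - d') * (d - d')) \<bullet> 1 = 0"
      by (subst expand) (intro sum.neutral, simp)
    then show False using \<open>d \<noteq> d'\<close> by simp
  qed
  then obtain M where M: "linear M" "L \<circ> M = id"
    using linear_injective_isomorphism[OF linL] by (auto simp: inj_on_def fun_eq_iff)
  define f where "f x = M (\<Sum>b\<in>Basis. g (smul b x) *\<^sub>R b)" for x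
  have Lf: "L (f x) = (\<Sum>b\<in>Basis. g (smul b x) *\<^sub>R b)" for x
    using M(2) by (simp add: f_def fun_eq_iff)
  have f_Basis: "(b * f x) \<bullet> 1 = g (smul b x)" if "b \<in> Basis" for b x
    using that by (simp add: L_inner[symmetric] Lf inner_sum_left inner_Basis if_distrib cong: if_cong)
  have f: "(c * f x) \<bullet> 1 = g (smul c x)" for c x
  proof -
    have "g (smul c x) = g (smul (\<Sum>b\<in>Basis. (c \<bullet> b) *\<^sub>R b) x)" by (simp add: euclidean_representation)
    also have "\<dots> = (\<Sum>b\<in>Basis. (c \<bullet> b) * g (smul b x))"
      by (simp add: scale_sum_left g.sum scaleR g.scaleR)
    finally show ?thesis by (subst expand) (simp add: f_Basis)
  qed
  have "f (x + y) = f x + f y" for x y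
    by (rule injL, rule euclidean_eqI)
       (simp add: L_inner f distrib_left inner_add_left scale_right_distrib g.add)
  moreover have "f (smul c x) = c * f x" for c x
    by (rule injL, rule euclidean_eqI)
       (simp add: L_inner f mult.assoc[symmetric])
  ultimately have "Vector_Spaces.linear smul (*) f"
    by unfold_locales (simp_all add: algebra_simps)
  moreover have "\<exists>B. \<forall>x. norm (f x) \<le> B * norm x"
  proof -
    obtain B where B: "\<And>x. norm (M x) \<le> B * norm x" "B \<ge> 0"
      using linear_bounded_pos[OF M(1)] by (metis less_imp_le)
    obtain G where G: "\<And>x. norm (g x) \<le> G * norm x" "G \<ge> 0"
      using g.nonneg_bounded by (metis mult.commute)
    have "norm (f x) \<le> (B * (\<Sum>b\<in>(Basis :: 'k set). G)) * norm x" for x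
    proof -
      have "norm (\<Sum>b\<in>Basis. g (smul b x) *\<^sub>R (b :: 'k)) \<le> (\<Sum>b\<in>(Basis :: 'k set). G * norm x)"
      proof (rule sum_norm_le)
        fix b :: 'k assume "b \<in> Basis"
        then show "norm (g (smul b x) *\<^sub>R b) \<le> G * norm x"
          using G(1)[of "smul b x"] by (simp add: norm_scale)
      qed
      then have "norm (f x) \<le> B * (\<Sum>b\<in>(Basis :: 'k set). G * norm x)"
        unfolding f_def using B by (meson mult_left_mono order_trans)
      then show ?thesis by (simp add: mult.assoc)
    qed
    then show ?thesis by blast
  qed
  moreover have "f v \<noteq> 0" using f[of 1 v] g(2) by auto
  ultimately show ?thesis by blast
qed

end

section \<open>Seminormed spaces with explicit carrier\<close>

text \<open>The record has neither a zero nor negation, so \<open>vscale X 0 y\<close> and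
  \<open>vscale X (- 1) y\<close> take their place. Seminorms are the right generality because the
  algebraic tensor product is completed as a seminormed space: \<open>null_rel\<close> identifies
  points at distance 0.\<close>

locale seminormed_space =
  fixes X :: "('k::real_normed_field, 'v) nspace"
  assumes add_closed [simp]: "x \<in> vcarrier X \<Longrightarrow> y \<in> vcarrier X \<Longrightarrow> vadd X x y \<in> vcarrier X"
    and scale_closed [simp]: "x \<in> vcarrier X \<Longrightarrow> vscale X c x \<in> vcarrier X"
    and carrier_nonempty: "vcarrier X \<noteq> {}"
    and add_assoc: "x \<in> vcarrier X \<Longrightarrow> y \<in> vcarrier X \<Longrightarrow> z \<in> vcarrier X \<Longrightarrow>
      vadd X (vadd X x y) z = vadd X x (vadd X y z)"
    and add_commute: "x \<in> vcarrier X \<Longrightarrow> y \<in> vcarrier X \<Longrightarrow> vadd X x y = vadd X y x"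
    and add_scale_zero: "x \<in> vcarrier X \<Longrightarrow> y \<in> vcarrier X \<Longrightarrow> vadd X x (vscale X 0 y) = x"
    and scale_one: "x \<in> vcarrier X \<Longrightarrow> vscale X 1 x = x"
    and scale_scale: "x \<in> vcarrier X \<Longrightarrow> vscale X c (vscale X d x) = vscale X (c * d) x"
    and scale_add_right: "x \<in> vcarrier X \<Longrightarrow> y \<in> vcarrier X \<Longrightarrow>
      vscale X c (vadd X x y) = vadd X (vscale X c x) (vscale X c y)"
    and scale_add_left: "x \<in> vcarrier X \<Longrightarrow>
      vscale X (c + d) x = vadd X (vscale X c x) (vscale X d x)"
    and norm_add: "x \<in> vcarrier X \<Longrightarrow> y \<in> vcarrier X \<Longrightarrow>
      vnorm X (vadd X x y) \<le> vnorm X x + vnorm X y"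
    and norm_scale: "x \<in> vcarrier X \<Longrightarrow> vnorm X (vscale X c x) = norm c * vnorm X x"
begin

lemma add_left_commute:
  assumes "x \<in> vcarrier X" "y \<in> vcarrier X" "z \<in> vcarrier X"
  shows "vadd X x (vadd X y z) = vadd X y (vadd X x z)"
  using assms by (metis add_assoc add_commute)

lemmas add_ac = add_assoc add_commute add_left_commute

lemma diff_closed [simp]: "x \<in> vcarrier X \<Longrightarrow> y \<in> vcarrier X \<Longrightarrow> vdiff X x y \<in> vcarrier X"
  by (simp add: vdiff_def)

lemma diff_self: "x \<in> vcarrier X \<Longrightarrow> vdiff X x x = vscale X 0 x"
  using scale_add_left[of x 1 "-1"] by (simp add: vdiff_def scale_one)

lemma norm_zero: "x \<in> vcarrier X \<Longrightarrow> vnorm X (vscale X 0 x) = 0"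
  by (simp add: norm_scale)

lemma norm_diff_self: "x \<in> vcarrier X \<Longrightarrow> vnorm X (vdiff X x x) = 0"
  by (simp add: diff_self norm_zero)

lemma diff_commute:
  "x \<in> vcarrier X \<Longrightarrow> y \<in> vcarrier X \<Longrightarrow> vdiff X y x = vscale X (- 1) (vdiff X x y)"
  by (simp add: vdiff_def scale_add_right scale_scale scale_one add_commute)

lemma norm_diff_commute:
  "x \<in> vcarrier X \<Longrightarrow> y \<in> vcarrier X \<Longrightarrow> vnorm X (vdiff X y x) = vnorm X (vdiff X x y)"
  by (simp add: diff_commute[of x y] norm_scale)

lemma diff_add_diff:
  assumes "x \<in> vcarrier X" "y \<in> vcarrier X" "z \<in> vcarrier X"
  shows "vadd X (vdiff X x y) (vdiff X y z) = vdiff X x z"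
proof -
  have "vadd X (vdiff X x y) (vdiff X y z) = vadd X (vdiff X x z) (vdiff X y y)"
    using assms by (simp add: vdiff_def add_ac)
  then show ?thesis using assms by (simp add: diff_self add_scale_zero)
qed

lemma norm_diff_triangle:
  assumes "x \<in> vcarrier X" "y \<in> vcarrier X" "z \<in> vcarrier X"
  shows "vnorm X (vdiff X x z) \<le> vnorm X (vdiff X x y) + vnorm X (vdiff X y z)"
  using assms by (metis diff_add_diff diff_closed norm_add)

lemma norm_nonneg: "x \<in> vcarrier X \<Longrightarrow> 0 \<le> vnorm X x"
  using norm_add[of x "vscale X (- 1) x"] norm_diff_self[of x] norm_scale[of x "-1"]
  by (simp add: vdiff_def)

lemma diff_add_cancel:
  "x \<in> vcarrier X \<Longrightarrow> y \<in> vcarrier X \<Longrightarrow> vadd X (vdiff X x y) y = x"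
proof -
  assume xy: "x \<in> vcarrier X" "y \<in> vcarrier X"
  then have "vadd X (vdiff X x y) y = vadd X x (vdiff X y y)"
    by (simp add: vdiff_def add_ac)
  then show ?thesis using xy by (simp add: diff_self add_scale_zero)
qed

lemma norm_le_norm_diff:
  "x \<in> vcarrier X \<Longrightarrow> y \<in> vcarrier X \<Longrightarrow> vnorm X x \<le> vnorm X y + vnorm X (vdiff X x y)"
  using norm_add[of "vdiff X x y" y] by (simp add: diff_add_cancel)

lemma norm_diff_ineq:
  assumes "x \<in> vcarrier X" "y \<in> vcarrier X"
  shows "\<bar>vnorm X x - vnorm X y\<bar> \<le> vnorm X (vdiff X x y)"
  using norm_le_norm_diff[of x y] norm_le_norm_diff[of y x] norm_diff_commute[of x y] assms by auto

lemma diff_add_add: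
  assumes "x \<in> vcarrier X" "y \<in> vcarrier X" "x' \<in> vcarrier X" "y' \<in> vcarrier X"
  shows "vdiff X (vadd X x y) (vadd X x' y') = vadd X (vdiff X x x') (vdiff X y y')"
  using assms by (simp add: vdiff_def scale_add_right add_ac)

lemma norm_diff_add_add:
  assumes "x \<in> vcarrier X" "y \<in> vcarrier X" "x' \<in> vcarrier X" "y' \<in> vcarrier X"
  shows "vnorm X (vdiff X (vadd X x y) (vadd X x' y')) \<le> vnorm X (vdiff X x x') + vnorm X (vdiff X y y')"
  using assms by (simp add: diff_add_add norm_add)

end

locale normed_space = seminormed_space +
  assumes norm_eq_zero: "x \<in> vcarrier X \<Longrightarrow> y \<in> vcarrier X \<Longrightarrow> vnorm X (vdiff X x y) = 0 \<Longrightarrow> x = y"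

lemma (in banach_algebra) normed_space_alg_space: "normed_space (alg_space smul)"
  by unfold_locales
     (simp_all add: alg_space_def vdiff_def scale_right_distrib scale_left_distrib
       norm_triangle_ineq norm_scale)

text \<open>With the scalars as a Banach algebra over themselves, scalar-valued forms and
  algebra-valued maps share one lifting theorem.\<close>

lemma banach_algebra_scalars:
  "banach_algebra ((*) :: 'k::{real_normed_field,euclidean_space} \<Rightarrow> 'k \<Rightarrow> 'k)"
  by unfold_locales (simp_all add: algebra_simps norm_mult scaleR_conv_of_real)

lemma scalars_eq_alg_space: "scalars = alg_space (*)"
  by (simp add: scalars_def alg_space_def)

section \<open>Bounded operators\<close>

lemma bounded_opsI:
  assumes "\<And>x. x \<in> vcarrier X \<Longrightarrow> f x \<in> vcarrier Y"
    and "\<And>x y. x \<in> vcarrier X \<Longrightarrow> y \<in> vcarrier X \<Longrightarrow> f (vadd X x y) = vadd Y (f x) (f y)"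
    and "\<And>c x. x \<in> vcarrier X \<Longrightarrow> f (vscale X c x) = vscale Y c (f x)"
    and "\<And>x. x \<in> vcarrier X \<Longrightarrow> vnorm Y (f x) \<le> B * vnorm X x"
    and "f \<in> extensional (vcarrier X)"
  shows "f \<in> bounded_ops X Y"
  using assms unfolding bounded_ops_def PiE_def by blast

lemma bounded_opsD:
  assumes "f \<in> bounded_ops X Y"
  shows "x \<in> vcarrier X \<Longrightarrow> f x \<in> vcarrier Y"
    and "x \<in> vcarrier X \<Longrightarrow> y \<in> vcarrier X \<Longrightarrow> f (vadd X x y) = vadd Y (f x) (f y)"
    and "x \<in> vcarrier X \<Longrightarrow> f (vscale X c x) = vscale Y c (f x)"
    and "f \<in> extensional (vcarrier X)"
  using assms by (auto simp: bounded_ops_def PiE_def)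

lemma bounded_ops_diff:
  assumes "f \<in> bounded_ops X Y" "seminormed_space X" "x \<in> vcarrier X" "y \<in> vcarrier X"
  shows "f (vdiff X x y) = vdiff Y (f x) (f y)"
  using assms by (simp add: vdiff_def bounded_opsD seminormed_space.scale_closed)

lemma bounded_ops_bound:
  assumes "f \<in> bounded_ops X Y" "seminormed_space X"
  obtains B where "B \<ge> 0" "\<And>x. x \<in> vcarrier X \<Longrightarrow> vnorm Y (f x) \<le> B * vnorm X x"
proof -
  obtain B where B: "\<And>x. x \<in> vcarrier X \<Longrightarrow> vnorm Y (f x) \<le> B * vnorm X x"
    using assms(1) unfolding bounded_ops_def by blast
  show thesis
  proof (rule that)
    fix x assume x: "x \<in> vcarrier X"
    have "B * vnorm X x \<le> max B 0 * vnorm X x"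
      using seminormed_space.norm_nonneg[OF assms(2) x] by (intro mult_right_mono) auto
    then show "vnorm Y (f x) \<le> max B 0 * vnorm X x" using B[OF x] by simp
  qed simp
qed

lemma bounded_ops_compose:
  assumes T: "T \<in> bounded_ops X Y" and S: "S \<in> bounded_ops Y Z"
    and X: "seminormed_space X" and Y: "seminormed_space Y"
  shows "(\<lambda>x\<in>vcarrier X. S (T x)) \<in> bounded_ops X Z"
proof -
  obtain B where B: "B \<ge> 0" "\<And>x. x \<in> vcarrier X \<Longrightarrow> vnorm Y (T x) \<le> B * vnorm X x"
    using bounded_ops_bound[OF T X] by blast
  obtain C where C: "C \<ge> 0" "\<And>x. x \<in> vcarrier Y \<Longrightarrow> vnorm Z (S x) \<le> C * vnorm Y x"
    using bounded_ops_bound[OF S Y] by blast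
  interpret X: seminormed_space X by (rule X)
  have "vnorm Z (S (T x)) \<le> (C * B) * vnorm X x" if x: "x \<in> vcarrier X" for x
  proof -
    have "vnorm Z (S (T x)) \<le> C * vnorm Y (T x)" using bounded_opsD(1)[OF T x] C by simp
    also have "\<dots> \<le> C * (B * vnorm X x)" using B(2)[OF x] C(1) by (intro mult_left_mono)
    finally show ?thesis by (simp add: mult.assoc)
  qed
  then show ?thesis
    by (intro bounded_opsI[where B = "C * B"]) (simp_all add: bounded_opsD[OF T] bounded_opsD[OF S])
qed

section \<open>Dual spaces\<close>

lemma dual_simps [simp]:
  "vcarrier (dual X) = bounded_ops X scalars"
  "vadd (dual X) = (\<lambda>f g. \<lambda>x\<in>vcarrier X. f x + g x)"
  "vscale (dual X) = (\<lambda>c f. \<lambda>x\<in>vcarrier X. c * f x)"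
  by (simp_all add: dual_def)

lemma scalars_simps [simp]:
  "vcarrier scalars = UNIV" "vadd scalars = (+)" "vscale scalars = (*)" "vnorm scalars = norm"
  by (simp_all add: scalars_def)

context seminormed_space begin

lemma dual_norm_le:
  assumes "\<And>x. x \<in> vcarrier X \<Longrightarrow> vnorm X x \<le> 1 \<Longrightarrow> norm (f x) \<le> B"
  shows "vnorm (dual X) f \<le> B"
proof -
  \<comment> \<open>The zero vector lies in the unit ball, so the supremum is not taken over the
    empty set, where it would be unspecified.\<close>
  obtain x where "x \<in> vcarrier X" using carrier_nonempty by blast
  then have "vscale X 0 x \<in> vcarrier X" "vnorm X (vscale X 0 x) \<le> 1" by (simp_all add: norm_zero)
  then have "{norm (f x) |x. x \<in> vcarrier X \<and> vnorm X x \<le> 1} \<noteq> {}" by blast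
  then show ?thesis
    unfolding dual_def using assms by (auto intro!: cSup_least)
qed

lemma norm_le_dual_norm:
  assumes f: "f \<in> bounded_ops X scalars" and x: "x \<in> vcarrier X" "vnorm X x \<le> 1"
  shows "norm (f x) \<le> vnorm (dual X) f"
proof -
  obtain B where B: "B \<ge> 0" "\<And>x. x \<in> vcarrier X \<Longrightarrow> norm (f x) \<le> B * vnorm X x"
    using bounded_ops_bound[OF f seminormed_space_axioms] by auto
  have "bdd_above {norm (f x) |x. x \<in> vcarrier X \<and> vnorm X x \<le> 1}"
  proof (rule bdd_aboveI)
    fix r assume "r \<in> {norm (f x) |x. x \<in> vcarrier X \<and> vnorm X x \<le> 1}"
    then obtain x where x: "r = norm (f x)" "x \<in> vcarrier X" "vnorm X x \<le> 1" by blast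
    have "B * vnorm X x \<le> B * 1" using B(1) x(3) by (intro mult_left_mono)
    then show "r \<le> B" using B(2)[OF x(2)] x(1) by simp
  qed
  then show ?thesis unfolding dual_def using x by (auto intro!: cSup_upper)
qed

lemma norm_apply_le:
  assumes f: "f \<in> bounded_ops X scalars" and x: "x \<in> vcarrier X"
  shows "norm (f x) \<le> vnorm (dual X) f * vnorm X x"
proof (cases "vnorm X x = 0")
  \<comment> \<open>A vector of seminorm 0 cannot be normalised, but any operator bound already
    forces \<open>f x = 0\<close>.\<close>
  case True
  obtain B where "\<And>x. x \<in> vcarrier X \<Longrightarrow> norm (f x) \<le> B * vnorm X x"
    using bounded_ops_bound[OF f seminormed_space_axioms] by auto
  from this[OF x] True show ?thesis by simp
next
  case False
  then have pos: "vnorm X x > 0" using norm_nonneg[OF x] by simp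
  define c :: 'k where "c = of_real (inverse (vnorm X x))"
  have c: "norm c = inverse (vnorm X x)" using pos by (simp add: c_def norm_inverse)
  have "norm (f (vscale X c x)) \<le> vnorm (dual X) f"
    using x pos by (intro norm_le_dual_norm f) (simp_all add: norm_scale c)
  then show ?thesis
    using x pos by (simp add: bounded_opsD(3)[OF f] norm_mult c field_simps)
qed

lemma seminormed_dual: "seminormed_space (dual X)"
proof
  fix f g :: "'v \<Rightarrow> 'k" and c
  assume f: "f \<in> vcarrier (dual X)"
  then have f': "f \<in> bounded_ops X scalars" by simp
  obtain B where B: "\<And>x. x \<in> vcarrier X \<Longrightarrow> norm (f x) \<le> B * vnorm X x"
    using bounded_ops_bound[OF f' seminormed_space_axioms] by auto
  have "(\<lambda>x\<in>vcarrier X. c * f x) \<in> bounded_ops X scalars"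
  proof (rule bounded_opsI[where B = "norm c * B"])
    fix x assume "x \<in> vcarrier X"
    then show "vnorm scalars ((\<lambda>x\<in>vcarrier X. c * f x) x) \<le> norm c * B * vnorm X x"
      using B[of x] by (simp add: norm_mult mult.assoc mult_left_mono)
  qed (simp_all add: bounded_opsD[OF f'] algebra_simps)
  then show scale_closed: "vscale (dual X) c f \<in> vcarrier (dual X)" by simp
  show "vscale (dual X) 1 f = f"
    using bounded_opsD(4)[OF f'] by (auto simp: fun_eq_iff extensional_def)
  show "vnorm (dual X) (vscale (dual X) c f) = norm c * vnorm (dual X) f"
  proof (rule antisym)
    show "vnorm (dual X) (vscale (dual X) c f) \<le> norm c * vnorm (dual X) f"
      using norm_le_dual_norm[OF f']
      by (intro dual_norm_le) (simp add: norm_mult mult_left_mono)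
    show "norm c * vnorm (dual X) f \<le> vnorm (dual X) (vscale (dual X) c f)"
    proof (cases "c = 0")
      case True
      \<comment> \<open>What remains is nonnegativity of the dual norm, read off at the zero
        vector.\<close>
      obtain x where x: "x \<in> vcarrier X" using carrier_nonempty by blast
      show ?thesis
        using norm_le_dual_norm[OF scale_closed[unfolded dual_simps], of "vscale X 0 x"] x True
        by (simp add: norm_zero)
    next
      case False
      have "vnorm (dual X) f \<le> vnorm (dual X) (vscale (dual X) c f) / norm c"
      proof (rule dual_norm_le)
        fix x assume "x \<in> vcarrier X" "vnorm X x \<le> 1"
        then show "norm (f x) \<le> vnorm (dual X) (vscale (dual X) c f) / norm c"
          using norm_le_dual_norm[OF scale_closed[unfolded dual_simps], of x] False
          by (simp add: norm_mult field_simps)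
      qed
      then show ?thesis using False by (simp add: field_simps)
    qed
  qed
  assume g: "g \<in> vcarrier (dual X)"
  then have g': "g \<in> bounded_ops X scalars" by simp
  obtain C where C: "\<And>x. x \<in> vcarrier X \<Longrightarrow> norm (g x) \<le> C * vnorm X x"
    using bounded_ops_bound[OF g' seminormed_space_axioms] by auto
  have "(\<lambda>x\<in>vcarrier X. f x + g x) \<in> bounded_ops X scalars"
  proof (rule bounded_opsI[where B = "B + C"])
    fix x assume x: "x \<in> vcarrier X"
    then show "vnorm scalars ((\<lambda>x\<in>vcarrier X. f x + g x) x) \<le> (B + C) * vnorm X x"
      using norm_triangle_ineq[of "f x" "g x"] B[OF x] C[OF x] by (simp add: algebra_simps)
  qed (simp_all add: bounded_opsD[OF f'] bounded_opsD[OF g'] algebra_simps)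
  then show "vadd (dual X) f g \<in> vcarrier (dual X)" by simp
  show "vadd (dual X) f (vscale (dual X) 0 g) = f"
    using bounded_opsD(4)[OF f'] by (auto simp: fun_eq_iff extensional_def)
  show "vnorm (dual X) (vadd (dual X) f g) \<le> vnorm (dual X) f + vnorm (dual X) g"
  proof (rule dual_norm_le)
    fix x assume "x \<in> vcarrier X" "vnorm X x \<le> 1"
    then show "norm (vadd (dual X) f g x) \<le> vnorm (dual X) f + vnorm (dual X) g"
      using norm_le_dual_norm[OF f', of x] norm_le_dual_norm[OF g', of x]
        norm_triangle_ineq[of "f x" "g x"] by simp
  qed
next
  have "(\<lambda>x\<in>vcarrier X. 0) \<in> bounded_ops X scalars"
    by (intro bounded_opsI[where B = 0]) simp_all
  then show "vcarrier (dual X) \<noteq> {}" by auto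
qed (auto simp: fun_eq_iff algebra_simps)

text \<open>By \<open>norm_apply_le\<close> a functional of norm 0 vanishes on the whole carrier,
  even if X is merely seminormed; extensionality then turns equality on the carrier into
  equality.\<close>

lemma normed_space_dual: "normed_space (dual X)"
proof -
  interpret D: seminormed_space "dual X" by (rule seminormed_dual)
  show ?thesis
  proof
    fix f g assume fg: "f \<in> vcarrier (dual X)" "g \<in> vcarrier (dual X)"
      and zero: "vnorm (dual X) (vdiff (dual X) f g) = 0"
    have d: "vdiff (dual X) f g \<in> bounded_ops X scalars" using D.diff_closed[OF fg] by simp
    have "f x = g x" if "x \<in> vcarrier X" for x
      using norm_apply_le[OF d that] zero that by (simp add: vdiff_def)
    then show "f = g"
      using fg by (auto simp: bounded_ops_def intro: PiE_ext)
  qed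
qed

lemma canon_in_bidual:
  assumes x: "x \<in> vcarrier X"
  shows "canon X x \<in> bounded_ops (dual X) scalars"
  unfolding canon_def
proof (rule bounded_opsI[where B = "vnorm X x"])
  fix f assume "f \<in> vcarrier (dual X)"
  then show "vnorm scalars ((\<lambda>f\<in>vcarrier (dual X). f x) f) \<le> vnorm X x * vnorm (dual X) f"
    using norm_apply_le[OF _ x, of f] by (simp add: mult.commute)
qed (use x seminormed_space.add_closed[OF seminormed_dual] seminormed_space.scale_closed[OF seminormed_dual] in auto)

end

lemma adjoint_op_bounded:
  assumes X: "seminormed_space X" and Y: "seminormed_space Y" and T: "T \<in> bounded_ops X Y"
  shows "adjoint_op X Y T \<in> bounded_ops (dual Y) (dual X)"
proof -
  interpret X: seminormed_space X by (rule X)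
  interpret Y: seminormed_space Y by (rule Y)
  interpret DY: seminormed_space "dual Y" by (rule Y.seminormed_dual)
  obtain B where B: "B \<ge> 0" "\<And>x. x \<in> vcarrier X \<Longrightarrow> vnorm Y (T x) \<le> B * vnorm X x"
    using bounded_ops_bound[OF T X] by blast
  show ?thesis
  proof (rule bounded_opsI[where B = B])
    fix g assume g: "g \<in> vcarrier (dual Y)"
    then have g': "g \<in> bounded_ops Y scalars" by simp
    have eq: "adjoint_op X Y T g = (\<lambda>x\<in>vcarrier X. g (T x))" using g by (simp add: adjoint_op_def)
    show "adjoint_op X Y T g \<in> vcarrier (dual X)"
      unfolding eq dual_simps by (rule bounded_ops_compose[OF T g' X Y])
    show "vnorm (dual X) (adjoint_op X Y T g) \<le> B * vnorm (dual Y) g"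
    proof (rule X.dual_norm_le)
      fix x assume x: "x \<in> vcarrier X" "vnorm X x \<le> 1"
      have "norm (g (T x)) \<le> vnorm (dual Y) g * vnorm Y (T x)"
        by (rule Y.norm_apply_le[OF g' bounded_opsD(1)[OF T x(1)]])
      also have "\<dots> \<le> vnorm (dual Y) g * (B * vnorm X x)"
        by (intro mult_left_mono B(2) x DY.norm_nonneg g)
      also have "\<dots> \<le> vnorm (dual Y) g * (B * 1)"
        by (intro mult_left_mono x B DY.norm_nonneg g)
      finally show "norm (adjoint_op X Y T g x) \<le> B * vnorm (dual Y) g"
        using x by (simp add: eq mult.commute)
    qed
  next
    fix f g assume fg: "f \<in> vcarrier (dual Y)" "g \<in> vcarrier (dual Y)"
    then show "adjoint_op X Y T (vadd (dual Y) f g) =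
        vadd (dual X) (adjoint_op X Y T f) (adjoint_op X Y T g)"
      using DY.add_closed[OF fg] by (auto simp: adjoint_op_def fun_eq_iff bounded_opsD(1)[OF T])
  next
    fix c f assume f: "f \<in> vcarrier (dual Y)"
    then show "adjoint_op X Y T (vscale (dual Y) c f) = vscale (dual X) c (adjoint_op X Y T f)"
      using DY.scale_closed[OF f, of c] by (auto simp: adjoint_op_def fun_eq_iff bounded_opsD(1)[OF T])
  qed (simp add: adjoint_op_def)
qed

lemma biadjoint_op_bounded:
  assumes "seminormed_space X" "seminormed_space Y" "T \<in> bounded_ops X Y"
  shows "biadjoint_op X Y T \<in> bounded_ops (bidual X) (bidual Y)"
  unfolding biadjoint_op_def
  using assms by (intro adjoint_op_bounded seminormed_space.seminormed_dual)

lemma biadjoint_op_apply: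
  assumes "F \<in> bounded_ops (dual X) scalars" "g \<in> bounded_ops Y scalars"
  shows "biadjoint_op X Y T F g = F (\<lambda>x\<in>vcarrier X. g (T x))"
  using assms by (simp add: biadjoint_op_def adjoint_op_def)

section \<open>Completion\<close>

lemma cauchy_seqsI:
  assumes "\<And>n. s n \<in> vcarrier X"
    and "\<And>e. e > 0 \<Longrightarrow> \<exists>M. \<forall>m\<ge>M. \<forall>n\<ge>M. vnorm X (vdiff X (s m) (s n)) < e"
  shows "s \<in> cauchy_seqs X"
  using assms by (simp add: cauchy_seqs_def)

lemma cauchy_seqsD:
  assumes "s \<in> cauchy_seqs X"
  shows "s n \<in> vcarrier X"
    and "e > 0 \<Longrightarrow> \<exists>M. \<forall>m\<ge>M. \<forall>n\<ge>M. vnorm X (vdiff X (s m) (s n)) < e"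
  using assms by (simp_all add: cauchy_seqs_def)

lemma tendsto_zero_le:
  fixes f :: "'b \<Rightarrow> real"
  assumes "(g \<longlongrightarrow> 0) F" "\<And>n. 0 \<le> f n" "\<And>n. f n \<le> g n"
  shows "(f \<longlongrightarrow> 0) F"
  by (rule tendsto_sandwich[OF _ _ tendsto_const assms(1)]) (simp_all add: assms)

abbreviation completion_class :: "('k::ring_1, 'v) nspace \<Rightarrow> (nat \<Rightarrow> 'v) \<Rightarrow> (nat \<Rightarrow> 'v) set" where
  "completion_class X s \<equiv> null_rel X `` {s}"

context seminormed_space begin

lemma cauchy_const: "x \<in> vcarrier X \<Longrightarrow> (\<lambda>_. x) \<in> cauchy_seqs X"
  by (simp add: cauchy_seqs_def norm_diff_self)

lemma cauchy_add:
  assumes s: "s \<in> cauchy_seqs X" and t: "t \<in> cauchy_seqs X"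
  shows "(\<lambda>n. vadd X (s n) (t n)) \<in> cauchy_seqs X"
proof (rule cauchy_seqsI)
  fix e :: real assume "e > 0"
  then have "e / 2 > 0" by simp
  obtain M where M: "\<And>m n. m \<ge> M \<Longrightarrow> n \<ge> M \<Longrightarrow> vnorm X (vdiff X (s m) (s n)) < e / 2"
    using cauchy_seqsD(2)[OF s \<open>e / 2 > 0\<close>] by blast
  obtain M' where M': "\<And>m n. m \<ge> M' \<Longrightarrow> n \<ge> M' \<Longrightarrow> vnorm X (vdiff X (t m) (t n)) < e / 2"
    using cauchy_seqsD(2)[OF t \<open>e / 2 > 0\<close>] by blast
  have "vnorm X (vdiff X (vadd X (s m) (t m)) (vadd X (s n) (t n))) < e"
    if "m \<ge> max M M'" "n \<ge> max M M'" for m n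
    using M[of m n] M'[of m n] that
      norm_diff_add_add[of "s m" "t m" "s n" "t n"] cauchy_seqsD(1)[OF s] cauchy_seqsD(1)[OF t]
    by (simp only: max.bounded_iff) (smt (verit) field_sum_of_halves)
  then show "\<exists>M. \<forall>m\<ge>M. \<forall>n\<ge>M. vnorm X (vdiff X (vadd X (s m) (t m)) (vadd X (s n) (t n))) < e"
    by blast
qed (simp add: cauchy_seqsD(1)[OF s] cauchy_seqsD(1)[OF t])

lemma cauchy_bounded_op:
  assumes s: "s \<in> cauchy_seqs X" and f: "f \<in> bounded_ops X Y"
  shows "(\<lambda>n. f (s n)) \<in> cauchy_seqs Y"
proof (rule cauchy_seqsI)
  obtain B where B: "B \<ge> 0" "\<And>x. x \<in> vcarrier X \<Longrightarrow> vnorm Y (f x) \<le> B * vnorm X x"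
    using bounded_ops_bound[OF f seminormed_space_axioms] by blast
  fix e :: real assume "e > 0"
  \<comment> \<open>B may be 0, hence the denominator B + 1.\<close>
  then have "e / (B + 1) > 0" using B(1) by simp
  then obtain M where M: "\<And>m n. m \<ge> M \<Longrightarrow> n \<ge> M \<Longrightarrow> vnorm X (vdiff X (s m) (s n)) < e / (B + 1)"
    using cauchy_seqsD(2)[OF s] by blast
  have "vnorm Y (vdiff Y (f (s m)) (f (s n))) < e" if "m \<ge> M" "n \<ge> M" for m n
  proof -
    have c: "s m \<in> vcarrier X" "s n \<in> vcarrier X" using cauchy_seqsD(1)[OF s] by auto
    have "vnorm Y (vdiff Y (f (s m)) (f (s n))) \<le> B * vnorm X (vdiff X (s m) (s n))"
      using B(2)[OF diff_closed[OF c]] bounded_ops_diff[OF f seminormed_space_axioms c] by simp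
    also have "\<dots> \<le> (B + 1) * vnorm X (vdiff X (s m) (s n))"
      by (intro mult_right_mono norm_nonneg diff_closed c) simp
    also have "\<dots> < e"
      using M[OF that] B(1) by (simp add: field_simps)
    finally show ?thesis .
  qed
  then show "\<exists>M. \<forall>m\<ge>M. \<forall>n\<ge>M. vnorm Y (vdiff Y (f (s m)) (f (s n))) < e" by blast
qed (simp add: cauchy_seqsD(1)[OF s] bounded_opsD(1)[OF f])

text \<open>Lets scalar multiplication inherit preservation of Cauchy sequences and of
  \<open>null_rel\<close> from the general facts on bounded operators.\<close>

lemma scale_bounded_op: "(\<lambda>x\<in>vcarrier X. vscale X c x) \<in> bounded_ops X X"
  by (intro bounded_opsI[where B = "norm c"]) (simp_all add: scale_add_right scale_scale norm_scale mult.commute)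

lemma cauchy_scale:
  assumes "s \<in> cauchy_seqs X"
  shows "(\<lambda>n. vscale X c (s n)) \<in> cauchy_seqs X"
  using cauchy_bounded_op[OF assms scale_bounded_op[of c]] cauchy_seqsD(1)[OF assms] by simp

lemma cauchy_norm_convergent:
  assumes s: "s \<in> cauchy_seqs X"
  shows "convergent (\<lambda>n. vnorm X (s n))"
proof (rule Cauchy_convergent, rule CauchyI)
  fix e :: real assume "e > 0"
  then obtain M where M: "\<And>m n. m \<ge> M \<Longrightarrow> n \<ge> M \<Longrightarrow> vnorm X (vdiff X (s m) (s n)) < e"
    using cauchy_seqsD(2)[OF s] by blast
  have "norm (vnorm X (s m) - vnorm X (s n)) < e" if "m \<ge> M" "n \<ge> M" for m n
    using M[OF that] norm_diff_ineq[of "s m" "s n"] cauchy_seqsD(1)[OF s] by (smt (verit) real_norm_def)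
  then show "\<exists>M. \<forall>m\<ge>M. \<forall>n\<ge>M. norm (vnorm X (s m) - vnorm X (s n)) < e" by blast
qed

lemma equiv_null_rel: "equiv (cauchy_seqs X) (null_rel X)"
proof (rule equivI)
  show "null_rel X \<subseteq> cauchy_seqs X \<times> cauchy_seqs X" by (auto simp: null_rel_def)
  show "refl_on (cauchy_seqs X) (null_rel X)"
    by (auto simp: refl_on_def null_rel_def norm_diff_self cauchy_seqsD(1))
  show "sym (null_rel X)"
    by (auto simp: sym_def null_rel_def norm_diff_commute cauchy_seqsD(1))
  show "trans (null_rel X)"
  proof (rule transI)
    fix s t u assume "(s, t) \<in> null_rel X" "(t, u) \<in> null_rel X"
    then have c: "s \<in> cauchy_seqs X" "t \<in> cauchy_seqs X" "u \<in> cauchy_seqs X"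
      and "(\<lambda>n. vnorm X (vdiff X (s n) (t n))) \<longlonglongrightarrow> 0" "(\<lambda>n. vnorm X (vdiff X (t n) (u n))) \<longlonglongrightarrow> 0"
      by (auto simp: null_rel_def)
    then have "(\<lambda>n. vnorm X (vdiff X (s n) (t n)) + vnorm X (vdiff X (t n) (u n))) \<longlonglongrightarrow> 0"
      using tendsto_add by fastforce
    then have "(\<lambda>n. vnorm X (vdiff X (s n) (u n))) \<longlonglongrightarrow> 0"
      by (rule tendsto_zero_le)
         (simp_all add: norm_nonneg norm_diff_triangle c[THEN cauchy_seqsD(1)])
    then show "(s, u) \<in> null_rel X" using c by (simp add: null_rel_def)
  qed
qed

lemma completion_carrierE:
  assumes "u \<in> vcarrier (completion X)"
  obtains s where "s \<in> cauchy_seqs X" "u = completion_class X s"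
  using assms by (auto simp: completion_def elim: quotientE)

lemma completion_carrierI:
  "s \<in> cauchy_seqs X \<Longrightarrow> completion_class X s \<in> vcarrier (completion X)"
  by (simp add: completion_def quotientI)

lemma completion_class_eq:
  assumes "s \<in> cauchy_seqs X" "t \<in> cauchy_seqs X"
  shows "completion_class X s = completion_class X t \<longleftrightarrow> (\<lambda>n. vnorm X (vdiff X (s n) (t n))) \<longlonglongrightarrow> 0"
  using eq_equiv_class_iff[OF equiv_null_rel assms] assms by (simp add: null_rel_def)

lemma completion_class_eqI:
  assumes "(s, t) \<in> null_rel X"
  shows "completion_class X s = completion_class X t"
  using equiv_class_eq[OF equiv_null_rel assms] .

text \<open>The definition takes a union over all representatives; as the operation respects
  \<open>null_rel\<close>, all members of this union are the same class. The same collapse serves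
  for scaling and for the norm.\<close>

lemma completion_add:
  assumes "s \<in> cauchy_seqs X" "t \<in> cauchy_seqs X"
  shows "vadd (completion X) (completion_class X s) (completion_class X t) =
    completion_class X (\<lambda>n. vadd X (s n) (t n))"
proof -
  have "congruent2 (null_rel X) (null_rel X) (\<lambda>s t. completion_class X (\<lambda>n. vadd X (s n) (t n)))"
  proof (rule congruent2I')
    fix s s' t t' assume st: "(s, s') \<in> null_rel X" "(t, t') \<in> null_rel X"
    then have c: "s \<in> cauchy_seqs X" "s' \<in> cauchy_seqs X" "t \<in> cauchy_seqs X" "t' \<in> cauchy_seqs X"
      and "(\<lambda>n. vnorm X (vdiff X (s n) (s' n)) + vnorm X (vdiff X (t n) (t' n))) \<longlonglongrightarrow> 0"
      by (auto simp: null_rel_def intro: tendsto_add_zero)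
    then have "(\<lambda>n. vnorm X (vdiff X (vadd X (s n) (t n)) (vadd X (s' n) (t' n)))) \<longlonglongrightarrow> 0"
      by (elim tendsto_zero_le)
         (simp_all add: norm_nonneg norm_diff_add_add c[THEN cauchy_seqsD(1)])
    then show "completion_class X (\<lambda>n. vadd X (s n) (t n)) = completion_class X (\<lambda>n. vadd X (s' n) (t' n))"
      using c by (simp add: completion_class_eq cauchy_add)
  qed
  then show ?thesis
    unfolding completion_def using assms UN_equiv_class2[OF equiv_null_rel equiv_null_rel] by simp
qed

lemma bounded_op_respects_null_rel:
  assumes f: "f \<in> bounded_ops X Y" and Y: "seminormed_space Y" and st: "(s, t) \<in> null_rel X"
  shows "(\<lambda>n. f (s n), \<lambda>n. f (t n)) \<in> null_rel Y"
proof -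
  obtain B where B: "B \<ge> 0" "\<And>x. x \<in> vcarrier X \<Longrightarrow> vnorm Y (f x) \<le> B * vnorm X x"
    using bounded_ops_bound[OF f seminormed_space_axioms] by blast
  have s: "s \<in> cauchy_seqs X" and t: "t \<in> cauchy_seqs X"
    and "(\<lambda>n. vnorm X (vdiff X (s n) (t n))) \<longlonglongrightarrow> 0"
    using st by (auto simp: null_rel_def)
  then have "(\<lambda>n. B * vnorm X (vdiff X (s n) (t n))) \<longlonglongrightarrow> 0"
    using tendsto_mult_right_zero by blast
  then have "(\<lambda>n. vnorm Y (vdiff Y (f (s n)) (f (t n)))) \<longlonglongrightarrow> 0"
  proof (rule tendsto_zero_le)
    fix n
    have c: "s n \<in> vcarrier X" "t n \<in> vcarrier X"
      using cauchy_seqsD(1)[OF s] cauchy_seqsD(1)[OF t] by auto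
    show "vnorm Y (vdiff Y (f (s n)) (f (t n))) \<le> B * vnorm X (vdiff X (s n) (t n))"
      using B(2)[OF diff_closed[OF c]] bounded_ops_diff[OF f seminormed_space_axioms c] by simp
    show "0 \<le> vnorm Y (vdiff Y (f (s n)) (f (t n)))"
      using c by (simp add: seminormed_space.norm_nonneg[OF Y] seminormed_space.diff_closed[OF Y]
          bounded_opsD(1)[OF f])
  qed
  then show ?thesis
    using cauchy_bounded_op[OF s f] cauchy_bounded_op[OF t f] by (simp add: null_rel_def)
qed

lemma completion_scale:
  assumes "s \<in> cauchy_seqs X"
  shows "vscale (completion X) c (completion_class X s) = completion_class X (\<lambda>n. vscale X c (s n))"
proof -
  have "congruent (null_rel X) (\<lambda>s. completion_class X (\<lambda>n. vscale X c (s n)))"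
  proof (rule congruentI)
    fix s t assume st: "(s, t) \<in> null_rel X"
    then have "s n \<in> vcarrier X" "t n \<in> vcarrier X" for n
      by (auto simp: null_rel_def cauchy_seqsD(1))
    then show "completion_class X (\<lambda>n. vscale X c (s n)) = completion_class X (\<lambda>n. vscale X c (t n))"
      using completion_class_eqI[OF bounded_op_respects_null_rel[OF scale_bounded_op[of c] seminormed_space_axioms st]]
      by simp
  qed
  then show ?thesis
    unfolding completion_def using assms UN_equiv_class[OF equiv_null_rel] by simp
qed

lemma null_rel_norm_lim:
  assumes "(s, t) \<in> null_rel X"
  shows "lim (\<lambda>n. vnorm X (s n)) = lim (\<lambda>n. vnorm X (t n))"
proof -
  have c: "s \<in> cauchy_seqs X" "t \<in> cauchy_seqs X"
    and *: "(\<lambda>n. vnorm X (vdiff X (s n) (t n))) \<longlonglongrightarrow> 0"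
    using assms by (auto simp: null_rel_def)
  have "(\<lambda>n. \<bar>vnorm X (s n) - vnorm X (t n)\<bar>) \<longlonglongrightarrow> 0"
    by (rule tendsto_zero_le[OF *]) (simp_all add: norm_diff_ineq c[THEN cauchy_seqsD(1)])
  then have "(\<lambda>n. vnorm X (s n) - vnorm X (t n)) \<longlonglongrightarrow> 0" by (simp add: tendsto_rabs_zero_iff)
  then have "(\<lambda>n. (vnorm X (s n) - vnorm X (t n)) + vnorm X (t n)) \<longlonglongrightarrow> 0 + lim (\<lambda>n. vnorm X (t n))"
    using cauchy_norm_convergent[OF c(2)] by (intro tendsto_add) (simp_all add: convergent_LIMSEQ_iff)
  then show ?thesis by (simp add: limI)
qed

lemma completion_norm:
  assumes s: "s \<in> cauchy_seqs X"
  shows "vnorm (completion X) (completion_class X s) = lim (\<lambda>n. vnorm X (s n))"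
proof -
  have "congruent (null_rel X) (\<lambda>s. {lim (\<lambda>n. vnorm X (s n))})"
    by (rule congruentI) (simp add: null_rel_norm_lim)
  from UN_equiv_class[OF equiv_null_rel this s] show ?thesis by (simp add: completion_def)
qed

lemma completion_norm_LIMSEQ:
  assumes s: "s \<in> cauchy_seqs X"
  shows "(\<lambda>n. vnorm X (s n)) \<longlonglongrightarrow> vnorm (completion X) (completion_class X s)"
  using cauchy_norm_convergent[OF s] by (simp add: completion_norm[OF s] convergent_LIMSEQ_iff)

lemma completion_diff:
  assumes "s \<in> cauchy_seqs X" "t \<in> cauchy_seqs X"
  shows "vdiff (completion X) (completion_class X s) (completion_class X t) =
    completion_class X (\<lambda>n. vdiff X (s n) (t n))"
  using assms by (simp add: vdiff_def completion_scale completion_add cauchy_scale)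

lemma cauchy_diff:
  "s \<in> cauchy_seqs X \<Longrightarrow> t \<in> cauchy_seqs X \<Longrightarrow> (\<lambda>n. vdiff X (s n) (t n)) \<in> cauchy_seqs X"
  by (simp add: vdiff_def cauchy_scale cauchy_add)

text \<open>Algebraic laws hold termwise for representatives, norm laws pass to the limit, and
  definiteness is what the quotient by \<open>null_rel\<close> provides.\<close>

lemma normed_space_completion: "normed_space (completion X)"
proof
  fix u v w c d
  assume u: "u \<in> vcarrier (completion X)"
  then obtain r where r: "r \<in> cauchy_seqs X" "u = completion_class X r" by (rule completion_carrierE)
  note rX = cauchy_seqsD(1)[OF r(1)]
  show "vscale (completion X) c u \<in> vcarrier (completion X)"
    using r by (simp add: completion_scale completion_carrierI cauchy_scale)
  show "vscale (completion X) 1 u = u"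
    using r rX by (simp add: completion_scale scale_one)
  show "vscale (completion X) c (vscale (completion X) d u) = vscale (completion X) (c * d) u"
    using r rX by (simp add: completion_scale cauchy_scale scale_scale)
  show "vscale (completion X) (c + d) u = vadd (completion X) (vscale (completion X) c u) (vscale (completion X) d u)"
    using r rX by (simp add: completion_scale completion_add cauchy_scale scale_add_left)
  have "(\<lambda>n. vnorm X (vscale X c (r n))) \<longlonglongrightarrow> norm c * vnorm (completion X) u"
    using r rX completion_norm_LIMSEQ[OF r(1)] by (simp add: norm_scale tendsto_mult_left)
  then show "vnorm (completion X) (vscale (completion X) c u) = norm c * vnorm (completion X) u"
    using completion_norm_LIMSEQ[OF cauchy_scale[OF r(1)]] r
    by (auto simp: completion_scale intro: LIMSEQ_unique)
  assume v: "v \<in> vcarrier (completion X)"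
  then obtain s where s: "s \<in> cauchy_seqs X" "v = completion_class X s" by (rule completion_carrierE)
  note sX = cauchy_seqsD(1)[OF s(1)]
  show "vadd (completion X) u v \<in> vcarrier (completion X)"
    using r s by (simp add: completion_add completion_carrierI cauchy_add)
  show "vadd (completion X) u v = vadd (completion X) v u"
    using r s rX sX by (simp add: completion_add add_commute)
  show "vadd (completion X) u (vscale (completion X) 0 v) = u"
    using r s rX sX by (simp add: completion_add completion_scale cauchy_scale add_scale_zero)
  show "vscale (completion X) c (vadd (completion X) u v) =
      vadd (completion X) (vscale (completion X) c u) (vscale (completion X) c v)"
    using r s rX sX by (simp add: completion_add completion_scale cauchy_scale cauchy_add scale_add_right)
  show "vnorm (completion X) (vadd (completion X) u v) \<le> vnorm (completion X) u + vnorm (completion X) v"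
    using completion_norm_LIMSEQ[OF cauchy_add[OF r(1) s(1)]]
      tendsto_add[OF completion_norm_LIMSEQ[OF r(1)] completion_norm_LIMSEQ[OF s(1)]] r s rX sX
    by (auto simp: completion_add norm_add intro: LIMSEQ_le)
  show "u = v" if "vnorm (completion X) (vdiff (completion X) u v) = 0"
    using completion_norm_LIMSEQ[OF cauchy_diff[OF r(1) s(1)]] r s that
    by (simp add: completion_diff completion_class_eq)
  assume w: "w \<in> vcarrier (completion X)"
  then obtain t where t: "t \<in> cauchy_seqs X" "w = completion_class X t" by (rule completion_carrierE)
  show "vadd (completion X) (vadd (completion X) u v) w = vadd (completion X) u (vadd (completion X) v w)"
    using r s t rX sX cauchy_seqsD(1)[OF t(1)] by (simp add: completion_add cauchy_add add_assoc)
next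
  show "vcarrier (completion X) \<noteq> {}"
    using carrier_nonempty cauchy_const completion_carrierI by blast
qed

section \<open>Density of a space in its completion; uniqueness and extension of operators\<close>

lemma completion_embed_closed: "x \<in> vcarrier X \<Longrightarrow> completion_embed X x \<in> vcarrier (completion X)"
  by (simp add: completion_embed_def completion_carrierI cauchy_const)

lemma completion_embed_add:
  "x \<in> vcarrier X \<Longrightarrow> y \<in> vcarrier X \<Longrightarrow>
    completion_embed X (vadd X x y) = vadd (completion X) (completion_embed X x) (completion_embed X y)"
  by (simp add: completion_embed_def completion_add cauchy_const)

lemma completion_embed_dense:
  assumes u: "u \<in> vcarrier (completion X)" and e: "e > 0"
  obtains x where "x \<in> vcarrier X" "vnorm (completion X) (vdiff (completion X) u (completion_embed X x)) < e"
proof -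
  obtain s where s: "s \<in> cauchy_seqs X" "u = completion_class X s"
    using completion_carrierE[OF u] .
  \<comment> \<open>Half of e, because the limit preserves only the weak inequality.\<close>
  obtain M where M: "\<And>m n. m \<ge> M \<Longrightarrow> n \<ge> M \<Longrightarrow> vnorm X (vdiff X (s m) (s n)) < e / 2"
    using cauchy_seqsD(2)[OF s(1), of "e / 2"] e by auto
  have M': "s M \<in> vcarrier X" by (rule cauchy_seqsD(1)[OF s(1)])
  have "(\<lambda>n. vnorm X (vdiff X (s n) (s M))) \<longlonglongrightarrow>
      vnorm (completion X) (vdiff (completion X) u (completion_embed X (s M)))"
    using completion_norm_LIMSEQ[OF cauchy_diff[OF s(1) cauchy_const[OF M']]]
    by (simp add: s completion_embed_def completion_diff cauchy_const M')
  then have "vnorm (completion X) (vdiff (completion X) u (completion_embed X (s M))) \<le> e / 2"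
    by (rule LIMSEQ_le_const2) (use M in \<open>force intro: less_imp_le\<close>)
  then show thesis using that[OF M'] e by simp
qed

text \<open>Two continuous maps agreeing on a dense set are at distance 0 everywhere, and
  definiteness of Y makes them equal. This is the source of uniqueness in
  \<open>tensor_lift\<close>.\<close>

lemma completion_op_eqI:
  assumes T: "T \<in> bounded_ops (completion X) Y" and T': "T' \<in> bounded_ops (completion X) Y"
    and Y: "normed_space Y"
    and eq: "\<And>x. x \<in> vcarrier X \<Longrightarrow> T (completion_embed X x) = T' (completion_embed X x)"
  shows "T = T'"
proof (rule extensionalityI)
  interpret C: normed_space "completion X" by (rule normed_space_completion)
  interpret Y: normed_space Y by (rule Y)
  obtain B where B: "B \<ge> 0" "\<And>x. x \<in> vcarrier (completion X) \<Longrightarrow> vnorm Y (T x) \<le> B * vnorm (completion X) x"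
    using bounded_ops_bound[OF T C.seminormed_space_axioms] by blast
  obtain B' where B': "B' \<ge> 0" "\<And>x. x \<in> vcarrier (completion X) \<Longrightarrow> vnorm Y (T' x) \<le> B' * vnorm (completion X) x"
    using bounded_ops_bound[OF T' C.seminormed_space_axioms] by blast
  fix u assume u: "u \<in> vcarrier (completion X)"
  have TY: "T u \<in> vcarrier Y" "T' u \<in> vcarrier Y"
    using bounded_opsD(1)[OF T u] bounded_opsD(1)[OF T' u] .
  have "vnorm Y (vdiff Y (T u) (T' u)) \<le> 0 + e" if e: "e > 0" for e
  proof -
    have "e / (B + B' + 1) > 0" using e B(1) B'(1) by simp
    then obtain x where x: "x \<in> vcarrier X"
      and ux: "vnorm (completion X) (vdiff (completion X) u (completion_embed X x)) < e / (B + B' + 1)"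
      using completion_embed_dense[OF u] by blast
    define v where "v = completion_embed X x"
    have v: "v \<in> vcarrier (completion X)" unfolding v_def by (rule completion_embed_closed[OF x])
    let ?d = "vnorm (completion X) (vdiff (completion X) u v)"
    have "vnorm Y (vdiff Y (T u) (T v)) \<le> B * ?d"
      using B(2)[OF C.diff_closed[OF u v]] bounded_ops_diff[OF T C.seminormed_space_axioms u v] by simp
    moreover have "vnorm Y (vdiff Y (T' u) (T' v)) \<le> B' * ?d"
      using B'(2)[OF C.diff_closed[OF u v]] bounded_ops_diff[OF T' C.seminormed_space_axioms u v] by simp
    moreover have Tv: "T v = T' v" "T v \<in> vcarrier Y"
      using eq[OF x] bounded_opsD(1)[OF T v] by (simp_all add: v_def)
    ultimately have "vnorm Y (vdiff Y (T u) (T' u)) \<le> B * ?d + B' * ?d"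
      using Y.norm_diff_triangle[OF TY(1) Tv(2) TY(2)] Y.norm_diff_commute[OF TY(2) Tv(2)] by simp
    also have "\<dots> \<le> (B + B' + 1) * ?d"
      using C.norm_nonneg[OF C.diff_closed[OF u v]] by (simp add: algebra_simps)
    also have "\<dots> \<le> e"
      using ux B(1) B'(1) by (simp add: v_def field_simps)
    finally show ?thesis by simp
  qed
  then have "vnorm Y (vdiff Y (T u) (T' u)) \<le> 0" by (rule field_le_epsilon)
  then show "T u = T' u"
    using TY Y.norm_nonneg[OF Y.diff_closed[OF TY]] by (intro Y.norm_eq_zero) auto
qed (rule bounded_opsD(4)[OF T] bounded_opsD(4)[OF T'])+

text \<open>Representatives are mapped termwise: the image of a Cauchy sequence is Cauchy in Y and
  thus already names a point of the completion.\<close>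

lemma completion_op_extend:
  assumes f: "f \<in> bounded_ops X Y" and Y: "seminormed_space Y"
  obtains T where "T \<in> bounded_ops (completion X) (completion Y)"
    "\<And>x. x \<in> vcarrier X \<Longrightarrow> T (completion_embed X x) = completion_embed Y (f x)"
proof -
  interpret Y: seminormed_space Y by (rule Y)
  define T where "T = (\<lambda>P\<in>vcarrier (completion X). \<Union>s\<in>P. completion_class Y (\<lambda>n. f (s n)))"
  have T: "T (completion_class X s) = completion_class Y (\<lambda>n. f (s n))" if s: "s \<in> cauchy_seqs X" for s
  proof -
    have "congruent (null_rel X) (\<lambda>s. completion_class Y (\<lambda>n. f (s n)))"
      by (rule congruentI, rule Y.completion_class_eqI, rule bounded_op_respects_null_rel[OF f Y])
    from UN_equiv_class[OF equiv_null_rel this s] show ?thesis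
      by (simp add: T_def completion_carrierI s)
  qed
  obtain B where B: "B \<ge> 0" "\<And>x. x \<in> vcarrier X \<Longrightarrow> vnorm Y (f x) \<le> B * vnorm X x"
    using bounded_ops_bound[OF f seminormed_space_axioms] by blast
  have "T \<in> bounded_ops (completion X) (completion Y)"
  proof (rule bounded_opsI[where B = B])
    fix u c assume "u \<in> vcarrier (completion X)"
    then obtain s where s: "s \<in> cauchy_seqs X" "u = completion_class X s" by (rule completion_carrierE)
    note sX = cauchy_seqsD(1)[OF s(1)] and fs = cauchy_bounded_op[OF s(1) f]
    show "T u \<in> vcarrier (completion Y)" using s fs by (simp add: T Y.completion_carrierI)
    show "T (vscale (completion X) c u) = vscale (completion Y) c (T u)"
      using s sX fs
      by (simp add: T completion_scale Y.completion_scale cauchy_scale bounded_opsD(3)[OF f])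
    show "vnorm (completion Y) (T u) \<le> B * vnorm (completion X) u"
      unfolding s T[OF s(1)]
      by (rule LIMSEQ_le[OF Y.completion_norm_LIMSEQ[OF fs] tendsto_mult_left[OF completion_norm_LIMSEQ[OF s(1)]]])
         (simp add: B(2) sX)
    fix v assume "v \<in> vcarrier (completion X)"
    then obtain t where t: "t \<in> cauchy_seqs X" "v = completion_class X t" by (rule completion_carrierE)
    show "T (vadd (completion X) u v) = vadd (completion Y) (T u) (T v)"
      using s sX fs t cauchy_seqsD(1)[OF t(1)] cauchy_bounded_op[OF t(1) f]
      by (simp add: T completion_add Y.completion_add cauchy_add bounded_opsD(2)[OF f])
  qed (simp add: T_def)
  moreover have "T (completion_embed X x) = completion_embed Y (f x)" if "x \<in> vcarrier X" for x
    using that by (simp add: completion_embed_def T cauchy_const)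
  ultimately show thesis by (rule that)
qed

end

context banach_algebra begin

lemma alg_space_simps [simp]:
  "vcarrier (alg_space smul) = UNIV" "vadd (alg_space smul) = (+)" "vscale (alg_space smul) = smul"
  "vnorm (alg_space smul) = norm" "vdiff (alg_space smul) x y = x - y"
  by (simp_all add: alg_space_def vdiff_def)

lemma bounded_linear_smul: "bounded_linear (smul c)"
proof (rule bounded_linear_intro[where K = "norm c"])
  show "smul c (r *\<^sub>R x) = r *\<^sub>R smul c x" for r x
    by (metis scale_left_commute scale_of_real)
qed (simp_all add: scale_right_distrib norm_scale mult.commute)

lemma cauchy_seqs_alg_space: "cauchy_seqs (alg_space smul) = Collect Cauchy"
  by (auto simp: cauchy_seqs_def Cauchy_iff)

text \<open>Here the target is the algebra itself, so the value is an actual limit of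
  \<open>f (s n)\<close>, which exists because the algebra is complete.\<close>

lemma completion_op_extend_banach:
  assumes X: "seminormed_space X" and f: "f \<in> bounded_ops X (alg_space smul)"
  obtains T where "T \<in> bounded_ops (completion X) (alg_space smul)"
    "\<And>x. x \<in> vcarrier X \<Longrightarrow> T (completion_embed X x) = f x"
proof -
  interpret X: seminormed_space X by (rule X)
  interpret A: normed_space "alg_space smul" by (rule normed_space_alg_space)
  have conv: "(\<lambda>n. f (s n)) \<longlonglongrightarrow> lim (\<lambda>n. f (s n))" if "s \<in> cauchy_seqs X" for s
    using X.cauchy_bounded_op[OF that f]
    by (simp add: cauchy_seqs_alg_space Cauchy_convergent_iff convergent_LIMSEQ_iff)
  define T where "T = (\<lambda>P\<in>vcarrier (completion X). the_elem (\<Union>s\<in>P. {lim (\<lambda>n. f (s n))}))"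
  have T: "T (completion_class X s) = lim (\<lambda>n. f (s n))" if s: "s \<in> cauchy_seqs X" for s
  proof -
    have "congruent (null_rel X) (\<lambda>s. {lim (\<lambda>n. f (s n))})"
    proof (rule congruentI)
      fix s t assume st: "(s, t) \<in> null_rel X"
      then have "s \<in> cauchy_seqs X" "t \<in> cauchy_seqs X" by (auto simp: null_rel_def)
      moreover have "(\<lambda>n. f (s n) - f (t n)) \<longlonglongrightarrow> 0"
        using X.bounded_op_respects_null_rel[OF f A.seminormed_space_axioms st]
        by (simp add: null_rel_def tendsto_norm_zero_iff)
      ultimately have "lim (\<lambda>n. f (s n)) - lim (\<lambda>n. f (t n)) = 0"
        by (intro LIMSEQ_unique[OF tendsto_diff[OF conv conv]])
      then show "{lim (\<lambda>n. f (s n))} = {lim (\<lambda>n. f (t n))}" by simp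
    qed
    from UN_equiv_class[OF X.equiv_null_rel this s] show ?thesis
      by (simp add: T_def X.completion_carrierI s)
  qed
  have T_LIMSEQ: "(\<lambda>n. f (s n)) \<longlonglongrightarrow> T (completion_class X s)" if "s \<in> cauchy_seqs X" for s
    using conv[OF that] by (simp add: T that)
  obtain B where B: "B \<ge> 0" "\<And>x. x \<in> vcarrier X \<Longrightarrow> norm (f x) \<le> B * vnorm X x"
    using bounded_ops_bound[OF f X] by (metis alg_space_simps(4))
  have "T \<in> bounded_ops (completion X) (alg_space smul)"
  proof (rule bounded_opsI[where B = B])
    fix u c assume "u \<in> vcarrier (completion X)"
    then obtain s where s: "s \<in> cauchy_seqs X" "u = completion_class X s" by (rule X.completion_carrierE)
    note sX = cauchy_seqsD(1)[OF s(1)]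
    show "T u \<in> vcarrier (alg_space smul)" by simp
    show "T (vscale (completion X) c u) = vscale (alg_space smul) c (T u)"
      using bounded_linear.tendsto[OF bounded_linear_smul[of c] T_LIMSEQ[OF s(1)]]
        T_LIMSEQ[OF X.cauchy_scale[OF s(1), of c]]
      by (auto simp: s(2) X.completion_scale s(1) bounded_opsD(3)[OF f] sX intro: LIMSEQ_unique)
    show "vnorm (alg_space smul) (T u) \<le> B * vnorm (completion X) u"
      unfolding s alg_space_simps
      by (rule LIMSEQ_le[OF tendsto_norm[OF T_LIMSEQ[OF s(1)]]
            tendsto_mult_left[OF X.completion_norm_LIMSEQ[OF s(1)]]])
         (simp add: B(2) sX)
    fix v assume "v \<in> vcarrier (completion X)"
    then obtain t where t: "t \<in> cauchy_seqs X" "v = completion_class X t" by (rule X.completion_carrierE)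
    show "T (vadd (completion X) u v) = vadd (alg_space smul) (T u) (T v)"
      using tendsto_add[OF T_LIMSEQ[OF s(1)] T_LIMSEQ[OF t(1)]]
        T_LIMSEQ[OF X.cauchy_add[OF s(1) t(1)]]
      by (auto simp: s(2) t(2) X.completion_add s(1) t(1) bounded_opsD(2)[OF f] sX
          cauchy_seqsD(1)[OF t(1)] intro: LIMSEQ_unique)
  qed (simp add: T_def)
  moreover have "T (completion_embed X x) = f x" if "x \<in> vcarrier X" for x
    using that by (simp add: completion_embed_def T X.cauchy_const)
  ultimately show thesis by (rule that)
qed

end

section \<open>The projective tensor product\<close>

definition bounded_bilinear_map ::
  "('k \<Rightarrow> 'a::real_normed_vector \<Rightarrow> 'a) \<Rightarrow> ('k \<Rightarrow> 'b::real_normed_vector \<Rightarrow> 'b) \<Rightarrow> ('a \<Rightarrow> 'a \<Rightarrow> 'b) \<Rightarrow> bool"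
  where
  "bounded_bilinear_map s s' h \<longleftrightarrow>
     (\<forall>a a' b. h (a + a') b = h a b + h a' b) \<and> (\<forall>a b b'. h a (b + b') = h a b + h a b') \<and>
     (\<forall>c a b. h (s c a) b = s' c (h a b)) \<and> (\<forall>c a b. h a (s c b) = s' c (h a b)) \<and>
     (\<exists>B. \<forall>a b. norm (h a b) \<le> B * (norm a * norm b))"

context banach_algebra begin

lemma linear_form_iff:
  "Vector_Spaces.linear smul (*) f \<longleftrightarrow> (\<forall>x y. f (x + y) = f x + f y) \<and> (\<forall>c x. f (smul c x) = c * f x)"
proof -
  have "vector_space ((*) :: 'k \<Rightarrow> 'k \<Rightarrow> 'k)" by unfold_locales (simp_all add: algebra_simps)
  then show ?thesis
    using vector_space_axioms
    by (simp add: Vector_Spaces.linear_def module_hom_def module_hom_axioms_def module_iff_vector_space)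
qed

lemma bilinear_form_iff:
  "bilinear_form smul \<phi> \<longleftrightarrow>
     (\<forall>a a' b. \<phi> (a + a') b = \<phi> a b + \<phi> a' b) \<and> (\<forall>a b b'. \<phi> a (b + b') = \<phi> a b + \<phi> a b') \<and>
     (\<forall>c a b. \<phi> (smul c a) b = c * \<phi> a b) \<and> (\<forall>c a b. \<phi> a (smul c b) = c * \<phi> a b)"
  unfolding bilinear_form_def linear_form_iff by blast

lemma bilinear_form_zero: "bilinear_form smul \<phi> \<Longrightarrow> \<phi> 0 b = 0"
  using bilinear_form_iff[of \<phi>] by (metis mult_zero_left scale_zero_left)

lemma tensor_sum_append:
  "tensor_sum smul (xs @ ys) = (\<lambda>\<phi>. tensor_sum smul xs \<phi> + tensor_sum smul ys \<phi>)"
  by (auto simp: tensor_sum_def fun_eq_iff)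

lemma tensor_sum_scale:
  "tensor_sum smul (map (\<lambda>(a, b). (smul c a, b)) xs) = (\<lambda>\<phi>. c * tensor_sum smul xs \<phi>)"
proof
  fix \<phi>
  show "tensor_sum smul (map (\<lambda>(a, b). (smul c a, b)) xs) \<phi> = c * tensor_sum smul xs \<phi>"
    by (induction xs) (auto simp: tensor_sum_def bilinear_form_iff distrib_left)
qed

lemma sum_list_norm_nonneg: "0 \<le> (\<Sum>(a, b)\<leftarrow>xs. norm (a :: 'a) * norm (b :: 'a))"
  by (induction xs) auto

lemma projective_norm_le: "projective_norm smul (tensor_sum smul xs) \<le> (\<Sum>(a, b)\<leftarrow>xs. norm a * norm b)"
  unfolding projective_norm_def
proof (rule cInf_lower)
  show "bdd_below {\<Sum>(a, b)\<leftarrow>ys. norm a * norm b |ys. tensor_sum smul xs = tensor_sum smul ys}"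
    by (intro bdd_belowI[where m = 0]) (auto simp: sum_list_norm_nonneg)
qed blast

lemma projective_norm_greatest:
  assumes "u \<in> range (tensor_sum smul)"
    and "\<And>xs. u = tensor_sum smul xs \<Longrightarrow> r \<le> (\<Sum>(a, b)\<leftarrow>xs. norm a * norm b)"
  shows "r \<le> projective_norm smul u"
  unfolding projective_norm_def using assms by (intro cInf_greatest) auto

text \<open>Scaling the first leg of every summand turns a representation of u into one of its
  multiple, at \<open>norm c\<close> times the cost.\<close>

lemma projective_norm_scale_le:
  assumes u: "u \<in> range (tensor_sum smul)"
  shows "projective_norm smul (\<lambda>\<phi>. c * u \<phi>) \<le> norm c * projective_norm smul u"
proof -
  have le: "projective_norm smul (\<lambda>\<phi>. c * u \<phi>) \<le> norm c * (\<Sum>(a, b)\<leftarrow>xs. norm a * norm b)"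
    if "u = tensor_sum smul xs" for xs
  proof -
    have "projective_norm smul (\<lambda>\<phi>. c * u \<phi>) \<le>
        (\<Sum>(a, b)\<leftarrow>map (\<lambda>(a, b). (smul c a, b)) xs. norm a * norm b)"
      unfolding that tensor_sum_scale[symmetric] by (rule projective_norm_le)
    also have "\<dots> = norm c * (\<Sum>(a, b)\<leftarrow>xs. norm a * norm b)"
      by (induction xs) (auto simp: norm_scale algebra_simps)
    finally show ?thesis .
  qed
  show ?thesis
  proof (cases "c = 0")
    case True
    then show ?thesis using le u by auto
  next
    case False
    then have "projective_norm smul (\<lambda>\<phi>. c * u \<phi>) / norm c \<le> projective_norm smul u"
      using le by (intro projective_norm_greatest u) (simp add: field_simps)
    then show ?thesis using False by (simp add: field_simps)
  qed
qed

lemma alg_tensor_simps [simp]: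
  "vcarrier (alg_tensor smul) = range (tensor_sum smul)"
  "vadd (alg_tensor smul) = (\<lambda>u v \<phi>. u \<phi> + v \<phi>)"
  "vscale (alg_tensor smul) = (\<lambda>c u \<phi>. c * u \<phi>)"
  "vnorm (alg_tensor smul) = projective_norm smul"
  by (simp_all add: alg_tensor_def)

lemma seminormed_space_alg_tensor: "seminormed_space (alg_tensor smul)"
proof
  fix u v :: "('a \<Rightarrow> 'a \<Rightarrow> 'k) \<Rightarrow> 'k" and c :: 'k
  assume u: "u \<in> vcarrier (alg_tensor smul)"
  show scale: "vscale (alg_tensor smul) c u \<in> vcarrier (alg_tensor smul)" for c
  proof -
    obtain xs where "u = tensor_sum smul xs" using u by auto
    then show ?thesis by (simp add: tensor_sum_scale[symmetric])
  qed
  show "vnorm (alg_tensor smul) (vscale (alg_tensor smul) c u) = norm c * vnorm (alg_tensor smul) u"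
  proof (rule antisym)
    show "norm c * vnorm (alg_tensor smul) u \<le> vnorm (alg_tensor smul) (vscale (alg_tensor smul) c u)"
    proof (cases "c = 0")
      case True
      then show ?thesis
        using scale[of c] by (auto intro!: projective_norm_greatest sum_list_norm_nonneg)
    next
      case False
      \<comment> \<open>The reverse inequality is the first one, applied to the scaled tensor and
        \<open>inverse c\<close>.\<close>
      then have "projective_norm smul u \<le> inverse (norm c) * projective_norm smul (\<lambda>\<phi>. c * u \<phi>)"
        using projective_norm_scale_le[of "\<lambda>\<phi>. c * u \<phi>" "inverse c"] scale[of c]
        by (simp add: mult.assoc[symmetric] norm_inverse)
      then show ?thesis using False by (simp add: field_simps)
    qed
  qed (use u projective_norm_scale_le in simp)
  assume v: "v \<in> vcarrier (alg_tensor smul)"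
  obtain xs ys where xs: "u = tensor_sum smul xs" and ys: "v = tensor_sum smul ys" using u v by auto
  show "vadd (alg_tensor smul) u v \<in> vcarrier (alg_tensor smul)"
    by (simp add: xs ys tensor_sum_append[symmetric])
  have le: "projective_norm smul (\<lambda>\<phi>. u \<phi> + v \<phi>) \<le>
      (\<Sum>(a, b)\<leftarrow>xs. norm a * norm b) + (\<Sum>(a, b)\<leftarrow>ys. norm a * norm b)"
    if "u = tensor_sum smul xs" "v = tensor_sum smul ys" for xs ys
    using projective_norm_le[of "xs @ ys"] by (simp add: that tensor_sum_append)
  \<comment> \<open>Concatenated representations represent the sum; the infima over representations
    of u and of v are again taken one at a time.\<close>
  have "projective_norm smul (\<lambda>\<phi>. u \<phi> + v \<phi>) - projective_norm smul v \<le> projective_norm smul u"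
  proof (rule projective_norm_greatest)
    fix xs assume xs: "u = tensor_sum smul xs"
    have "projective_norm smul (\<lambda>\<phi>. u \<phi> + v \<phi>) - (\<Sum>(a, b)\<leftarrow>xs. norm a * norm b) \<le> projective_norm smul v"
    proof (rule projective_norm_greatest)
      fix ys assume ys: "v = tensor_sum smul ys"
      show "projective_norm smul (\<lambda>\<phi>. u \<phi> + v \<phi>) - (\<Sum>(a, b)\<leftarrow>xs. norm a * norm b) \<le>
          (\<Sum>(a, b)\<leftarrow>ys. norm a * norm b)"
        using le[OF xs ys] by simp
    qed (use v in simp)
    then show "projective_norm smul (\<lambda>\<phi>. u \<phi> + v \<phi>) - projective_norm smul v \<le>
        (\<Sum>(a, b)\<leftarrow>xs. norm a * norm b)"
      by simp
  qed (use u in simp)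
  then show "vnorm (alg_tensor smul) (vadd (alg_tensor smul) u v) \<le>
      vnorm (alg_tensor smul) u + vnorm (alg_tensor smul) v"
    by simp
qed (auto simp: algebra_simps)

lemma normed_space_proj_tensor: "normed_space (proj_tensor smul)"
  unfolding proj_tensor_def
  by (rule seminormed_space.normed_space_completion[OF seminormed_space_alg_tensor])

lemma seminormed_space_proj_tensor: "seminormed_space (proj_tensor smul)"
  by (rule normed_space.axioms(1)[OF normed_space_proj_tensor])

lemma tens_closed: "tens smul a b \<in> vcarrier (proj_tensor smul)"
  unfolding tens_def proj_tensor_def
  by (rule seminormed_space.completion_embed_closed[OF seminormed_space_alg_tensor]) simp

text \<open>Additivity reduces finite sums to elementary tensors, and finite sums are dense in the
  completion.\<close>

lemma tensor_op_eqI: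
  assumes T: "T \<in> bounded_ops (proj_tensor smul) Y" and T': "T' \<in> bounded_ops (proj_tensor smul) Y"
    and Y: "normed_space Y" and eq: "\<And>a b. T (tens smul a b) = T' (tens smul a b)"
  shows "T = T'"
proof (rule seminormed_space.completion_op_eqI[OF seminormed_space_alg_tensor _ _ Y])
  interpret X: seminormed_space "alg_tensor smul" by (rule seminormed_space_alg_tensor)
  let ?e = "completion_embed (alg_tensor smul)"
  fix u assume "u \<in> vcarrier (alg_tensor smul)"
  then obtain xs where u: "u = tensor_sum smul xs" by auto
  have "T (?e (tensor_sum smul xs)) = T' (?e (tensor_sum smul xs))"
  proof (induction xs)
    case Nil
    \<comment> \<open>The empty sum is itself an elementary tensor, so the hypothesis covers
      it.\<close>
    have "tensor_sum smul [] = tensor_sum smul [(0, 0)]"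
      using bilinear_form_zero by (auto simp: tensor_sum_def fun_eq_iff)
    then show ?case using eq[of 0 0] by (simp add: tens_def)
  next
    case (Cons p xs)
    obtain a b where p: "p = (a, b)" by (cases p)
    have "?e (tensor_sum smul (p # xs)) = vadd (proj_tensor smul) (tens smul a b) (?e (tensor_sum smul xs))"
      using X.completion_embed_add[of "tensor_sum smul [p]" "tensor_sum smul xs"]
      by (simp add: p tens_def proj_tensor_def tensor_sum_append[of "[(a, b)]" xs, simplified])
    moreover have "?e (tensor_sum smul xs) \<in> vcarrier (proj_tensor smul)"
      unfolding proj_tensor_def by (intro X.completion_embed_closed) simp
    ultimately show ?case
      using Cons.IH by (simp add: bounded_opsD(2)[OF T] bounded_opsD(2)[OF T'] tens_closed eq)
  qed
  then show "T (?e u) = T' (?e u)" by (simp add: u)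
qed (use T T' in \<open>simp_all add: proj_tensor_def\<close>)

text \<open>Resolves the definite description: exhibiting one operator with the right values
  suffices, since \<open>tensor_op_eqI\<close> excludes any other.\<close>

lemma tensor_lift_eqI:
  assumes "T \<in> bounded_ops (proj_tensor smul) Y" "normed_space Y"
    and "\<And>a b. T (tens smul a b) = h a b"
  shows "tensor_lift smul Y h = T"
  unfolding tensor_lift_def
  using assms by (intro the_equality) (auto intro!: tensor_op_eqI[where Y = Y])

text \<open>The operator S \<otimes> R, with both module actions as instances. It is defined by
  duality, substituting S and R into the forms on which tensors are evaluated, so that no
  representation has to be chosen.\<close>

lemma tensor_op_pair:
  assumes S: "S \<in> bounded_ops (alg_space smul) (alg_space smul)"
    and R: "R \<in> bounded_ops (alg_space smul) (alg_space smul)"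
  obtains T where "T \<in> bounded_ops (proj_tensor smul) (proj_tensor smul)"
    "\<And>a b. T (tens smul a b) = tens smul (S a) (R b)"
proof -
  interpret X: seminormed_space "alg_tensor smul" by (rule seminormed_space_alg_tensor)
  interpret A: normed_space "alg_space smul" by (rule normed_space_alg_space)
  \<comment> \<open>The value 0 off the bilinear forms repeats the convention of
    \<open>tensor_sum\<close>; without it the image would not be a tensor sum.\<close>
  define f where "f = (\<lambda>u\<in>vcarrier (alg_tensor smul). \<lambda>\<phi>.
    if bilinear_form smul \<phi> then u (\<lambda>a b. \<phi> (S a) (R b)) else 0)"
  have bil: "bilinear_form smul (\<lambda>a b. \<phi> (S a) (R b))" if "bilinear_form smul \<phi>" for \<phi>
    using that bounded_opsD(2,3)[OF S] bounded_opsD(2,3)[OF R] by (simp add: bilinear_form_iff)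
  have f: "f (tensor_sum smul xs) = tensor_sum smul (map (\<lambda>(a, b). (S a, R b)) xs)" for xs
    by (auto simp: f_def fun_eq_iff tensor_sum_def bil o_def case_prod_unfold)
  obtain B where B: "B \<ge> 0" "\<And>x. norm (S x) \<le> B * norm x"
    using bounded_ops_bound[OF S A.seminormed_space_axioms] by (metis UNIV_I alg_space_simps(1,4))
  obtain C where C: "C \<ge> 0" "\<And>x. norm (R x) \<le> C * norm x"
    using bounded_ops_bound[OF R A.seminormed_space_axioms] by (metis UNIV_I alg_space_simps(1,4))
  \<comment> \<open>The summand 1 makes D positive, so that costs can be divided by it.\<close>
  define D where "D = B * C + 1"
  have D: "D > 0" using B(1) C(1) by (simp add: D_def add_nonneg_pos)
  have cost: "norm (S a) * norm (R b) \<le> D * (norm a * norm b)" for a b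
  proof -
    have "norm (S a) * norm (R b) \<le> (B * norm a) * (C * norm b)"
      using B C by (intro mult_mono) auto
    also have "\<dots> \<le> D * (norm a * norm b)" by (simp add: D_def algebra_simps)
    finally show ?thesis .
  qed
  have "f \<in> bounded_ops (alg_tensor smul) (alg_tensor smul)"
  proof (rule bounded_opsI[where B = D])
    fix u c assume u: "u \<in> vcarrier (alg_tensor smul)"
    then show "f u \<in> vcarrier (alg_tensor smul)" using f by auto
    show "f (vscale (alg_tensor smul) c u) = vscale (alg_tensor smul) c (f u)"
      using X.scale_closed[OF u, of c] u by (auto simp: f_def)
    have "projective_norm smul (f u) / D \<le> projective_norm smul u"
    proof (rule projective_norm_greatest)
      fix xs assume u: "u = tensor_sum smul xs"
      have "projective_norm smul (f u) \<le> (\<Sum>(a, b)\<leftarrow>map (\<lambda>(a, b). (S a, R b)) xs. norm a * norm b)"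
        unfolding u f by (rule projective_norm_le)
      also have "\<dots> \<le> D * (\<Sum>(a, b)\<leftarrow>xs. norm a * norm b)"
        by (induction xs) (auto simp: distrib_left intro!: add_mono cost)
      finally show "projective_norm smul (f u) / D \<le> (\<Sum>(a, b)\<leftarrow>xs. norm a * norm b)"
        using D by (simp add: field_simps)
    qed (use u in simp)
    then show "vnorm (alg_tensor smul) (f u) \<le> D * vnorm (alg_tensor smul) u"
      using D by (simp add: field_simps)
    fix v assume v: "v \<in> vcarrier (alg_tensor smul)"
    show "f (vadd (alg_tensor smul) u v) = vadd (alg_tensor smul) (f u) (f v)"
      using X.add_closed[OF u v] u v by (auto simp: f_def)
  qed (simp add: f_def)
  then obtain T where bounded: "T \<in> bounded_ops (proj_tensor smul) (proj_tensor smul)"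
    and T: "\<And>x. x \<in> vcarrier (alg_tensor smul) \<Longrightarrow>
      T (completion_embed (alg_tensor smul) x) = completion_embed (alg_tensor smul) (f x)"
    using X.completion_op_extend[OF _ X.seminormed_space_axioms] unfolding proj_tensor_def by blast
  have "T (tens smul a b) = tens smul (S a) (R b)" for a b
    by (simp add: tens_def T f)
  with bounded show thesis by (rule that)
qed

lemma id_bounded_op: "(\<lambda>x. x) \<in> bounded_ops (alg_space smul) (alg_space smul)"
  by (rule bounded_opsI[where B = 1]) auto

lemma mult_left_bounded_op: "(\<lambda>x. a * x) \<in> bounded_ops (alg_space smul) (alg_space smul)"
  by (rule bounded_opsI[where B = "norm a"])
     (simp_all add: distrib_left scale_mult_right norm_mult_ineq)

lemma mult_right_bounded_op: "(\<lambda>x. x * a) \<in> bounded_ops (alg_space smul) (alg_space smul)"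
  by (rule bounded_opsI[where B = "norm a"])
     (simp_all add: distrib_right scale_mult_left norm_mult_ineq mult.commute[of "norm a"])

lemma tensor_lact:
  shows "tensor_lact smul a \<in> bounded_ops (proj_tensor smul) (proj_tensor smul)"
    and "tensor_lact smul a (tens smul b c) = tens smul (a * b) c"
proof -
  obtain T where T: "T \<in> bounded_ops (proj_tensor smul) (proj_tensor smul)"
    "\<And>b c. T (tens smul b c) = tens smul (a * b) c"
    using tensor_op_pair[OF mult_left_bounded_op id_bounded_op] by metis
  have "tensor_lact smul a = T"
    unfolding tensor_lact_def by (rule tensor_lift_eqI[OF T(1) normed_space_proj_tensor T(2)])
  with T show "tensor_lact smul a \<in> bounded_ops (proj_tensor smul) (proj_tensor smul)"
    "tensor_lact smul a (tens smul b c) = tens smul (a * b) c" by simp_all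
qed

lemma tensor_ract:
  shows "tensor_ract smul a \<in> bounded_ops (proj_tensor smul) (proj_tensor smul)"
    and "tensor_ract smul a (tens smul b c) = tens smul b (c * a)"
proof -
  obtain T where T: "T \<in> bounded_ops (proj_tensor smul) (proj_tensor smul)"
    "\<And>b c. T (tens smul b c) = tens smul b (c * a)"
    using tensor_op_pair[OF id_bounded_op mult_right_bounded_op] by metis
  have "tensor_ract smul a = T"
    unfolding tensor_ract_def by (rule tensor_lift_eqI[OF T(1) normed_space_proj_tensor T(2)])
  with T show "tensor_ract smul a \<in> bounded_ops (proj_tensor smul) (proj_tensor smul)"
    "tensor_ract smul a (tens smul b c) = tens smul b (c * a)" by simp_all
qed

text \<open>
  Well-definedness of the lift on \<open>tensor_sum smul xs\<close>, which only knows scalar-valued bilinear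
  forms, needs enough functionals on the target.
\<close>

lemma tensor_sum_eq_imp_sum_list_eq:
  fixes smul' :: "'k \<Rightarrow> 'b::{real_normed_algebra,banach} \<Rightarrow> 'b"
  assumes B: "banach_algebra smul'" and h: "bounded_bilinear_map smul smul' h"
    and eq: "tensor_sum smul xs = tensor_sum smul ys"
  shows "(\<Sum>(a, b)\<leftarrow>xs. h a b) = (\<Sum>(a, b)\<leftarrow>ys. h a b)"
proof (rule ccontr)
  interpret B: banach_algebra smul' by (rule B)
  assume "\<not> ?thesis"
  then have "(\<Sum>(a, b)\<leftarrow>xs. h a b) - (\<Sum>(a, b)\<leftarrow>ys. h a b) \<noteq> 0" by simp
  then obtain g where "Vector_Spaces.linear smul' (*) g"
    and ne: "g ((\<Sum>(a, b)\<leftarrow>xs. h a b) - (\<Sum>(a, b)\<leftarrow>ys. h a b)) \<noteq> 0"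
    using B.separating_functional by blast
  then have g: "g (x + y) = g x + g y" "g (smul' c x) = c * g x" for x y c
    using B.linear_form_iff by auto
  interpret g: additive g by unfold_locales (rule g(1))
  have "bilinear_form smul (\<lambda>a b. g (h a b))"
    using h by (simp add: bilinear_form_iff bounded_bilinear_map_def g)
  moreover have "g (\<Sum>(a, b)\<leftarrow>zs. h a b) = (\<Sum>(a, b)\<leftarrow>zs. g (h a b))" for zs
    by (induction zs) (auto simp: g.zero g.add)
  ultimately have "g (\<Sum>(a, b)\<leftarrow>xs. h a b) = g (\<Sum>(a, b)\<leftarrow>ys. h a b)"
    using fun_cong[OF eq, of "\<lambda>a b. g (h a b)"] by (simp add: tensor_sum_def)
  then show False using ne by (simp add: g.diff)
qed

text \<open>Any representation of a tensor may be chosen to evaluate h, as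
  \<open>tensor_sum_eq_imp_sum_list_eq\<close> gives independence of the choice. Minimising over
  representations bounds the result by the projective norm, and completeness of the target extends
  it.\<close>

lemma tensor_lift:
  fixes smul' :: "'k \<Rightarrow> 'b::{real_normed_algebra,banach} \<Rightarrow> 'b"
  assumes B: "banach_algebra smul'" and h: "bounded_bilinear_map smul smul' h"
  shows "tensor_lift smul (alg_space smul') h \<in> bounded_ops (proj_tensor smul) (alg_space smul')"
    and "tensor_lift smul (alg_space smul') h (tens smul a b) = h a b"
proof -
  interpret B: banach_algebra smul' by (rule B)
  interpret X: seminormed_space "alg_tensor smul" by (rule seminormed_space_alg_tensor)
  obtain C' where C': "\<And>a b. norm (h a b) \<le> C' * (norm a * norm b)"
    using h by (auto simp: bounded_bilinear_map_def)
  define C where "C = max C' 1"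
  have C: "C > 0" "norm (h a b) \<le> C * (norm a * norm b)" for a b
  proof -
    have "C' * (norm a * norm b) \<le> C * (norm a * norm b)"
      by (intro mult_right_mono) (simp_all add: C_def)
    then show "norm (h a b) \<le> C * (norm a * norm b)" using C'[of a b] by simp
  qed (simp add: C_def)
  define f where "f = (\<lambda>u\<in>vcarrier (alg_tensor smul).
    \<Sum>(a, b)\<leftarrow>(SOME xs. u = tensor_sum smul xs). h a b)"
  have f: "f (tensor_sum smul xs) = (\<Sum>(a, b)\<leftarrow>xs. h a b)" for xs
  proof -
    have "tensor_sum smul xs = tensor_sum smul (SOME ys. tensor_sum smul xs = tensor_sum smul ys)"
      by (rule someI) (rule refl)
    from tensor_sum_eq_imp_sum_list_eq[OF B h this] show ?thesis by (simp add: f_def)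
  qed
  have "f \<in> bounded_ops (alg_tensor smul) (alg_space smul')"
  proof (rule bounded_opsI[where B = C])
    fix u c assume u: "u \<in> vcarrier (alg_tensor smul)"
    then obtain xs where xs: "u = tensor_sum smul xs" by auto
    show "f u \<in> vcarrier (alg_space smul')" by simp
    have "(\<Sum>(a, b)\<leftarrow>map (\<lambda>(a, b). (smul c a, b)) xs. h a b) = smul' c (\<Sum>(a, b)\<leftarrow>xs. h a b)"
      using h by (induction xs) (auto simp: bounded_bilinear_map_def B.scale_right_distrib)
    then show "f (vscale (alg_tensor smul) c u) = vscale (alg_space smul') c (f u)"
      by (simp add: xs tensor_sum_scale[symmetric] f)
    have "norm (f u) / C \<le> projective_norm smul u"
    proof (rule projective_norm_greatest)
      fix xs assume u: "u = tensor_sum smul xs"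
      have "norm (f u) \<le> C * (\<Sum>(a, b)\<leftarrow>xs. norm a * norm b)"
        unfolding u f
        by (induction xs) (auto simp: distrib_left intro!: norm_triangle_le add_mono C(2))
      then show "norm (f u) / C \<le> (\<Sum>(a, b)\<leftarrow>xs. norm a * norm b)"
        using C(1) by (simp add: field_simps)
    qed (use u in simp)
    then show "vnorm (alg_space smul') (f u) \<le> C * vnorm (alg_tensor smul) u"
      using C(1) by (simp add: field_simps)
    fix v assume "v \<in> vcarrier (alg_tensor smul)"
    then obtain ys where ys: "v = tensor_sum smul ys" by auto
    show "f (vadd (alg_tensor smul) u v) = vadd (alg_space smul') (f u) (f v)"
      by (simp add: xs ys tensor_sum_append[symmetric] f)
  qed (simp add: f_def)
  then obtain T where T: "T \<in> bounded_ops (proj_tensor smul) (alg_space smul')"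
    and "\<And>x. x \<in> vcarrier (alg_tensor smul) \<Longrightarrow> T (completion_embed (alg_tensor smul) x) = f x"
    using B.completion_op_extend_banach[OF X.seminormed_space_axioms] unfolding proj_tensor_def by blast
  then have "T (tens smul a b) = h a b" for a b by (simp add: tens_def f)
  moreover from this have "tensor_lift smul (alg_space smul') h = T"
    by (intro tensor_lift_eqI[OF T B.normed_space_alg_space])
  ultimately show "tensor_lift smul (alg_space smul') h \<in> bounded_ops (proj_tensor smul) (alg_space smul')"
    "tensor_lift smul (alg_space smul') h (tens smul a b) = h a b"
    using T by simp_all
qed

end

section \<open>Johnson pseudo-contractible Banach algebras\<close>

text \<open>Directedness makes the tails a filter base: the tail of a common upper bound lies in
  both given tails, by transitivity.\<close>

lemma eventually_tail_filter:
  assumes I: "directed_set I le"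
  shows "eventually Q (tail_filter I le) \<longleftrightarrow> (\<exists>i\<in>I. \<forall>j\<in>I. le i j \<longrightarrow> Q j)"
proof -
  have nonempty: "I \<noteq> {}"
    and trans: "\<And>i j k. i \<in> I \<Longrightarrow> j \<in> I \<Longrightarrow> k \<in> I \<Longrightarrow> le i j \<Longrightarrow> le j k \<Longrightarrow> le i k"
    and upper: "\<And>i j. i \<in> I \<Longrightarrow> j \<in> I \<Longrightarrow> \<exists>k\<in>I. le i k \<and> le j k"
    using I unfolding directed_set_def by (elim conjE, assumption | elim conjE, metis)+
  have "\<exists>k\<in>I. principal {l \<in> I. le k l} \<le> inf (principal {l \<in> I. le i l}) (principal {l \<in> I. le j l})"
    if i: "i \<in> I" and j: "j \<in> I" for i j
  proof -
    obtain k where k: "k \<in> I" "le i k" "le j k" using upper[OF i j] by (elim bexE conjE)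
    have "{l \<in> I. le k l} \<subseteq> {l \<in> I. le i l} \<inter> {l \<in> I. le j l}"
    proof
      fix l assume "l \<in> {l \<in> I. le k l}"
      then show "l \<in> {l \<in> I. le i l} \<inter> {l \<in> I. le j l}"
        using trans[OF i k(1) _ k(2)] trans[OF j k(1) _ k(3)] by simp
    qed
    with k(1) show ?thesis by (intro bexI[of _ k]) simp_all
  qed
  with nonempty have "eventually Q (tail_filter I le) \<longleftrightarrow>
      (\<exists>i\<in>I. eventually Q (principal {j \<in> I. le i j}))"
    unfolding tail_filter_def by (intro eventually_INF_base)
  then show ?thesis by (simp add: eventually_principal Ball_def imp_conjL)
qed

section \<open>Elements of the bidual evaluated on bounded bilinear forms\<close>

context banach_algebra begin

lemma normed_space_scalars: "normed_space (scalars :: ('k, 'k) nspace)"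
  using banach_algebra.normed_space_alg_space[OF banach_algebra_scalars] by (simp add: scalars_eq_alg_space)

abbreviation form_lift :: "('a \<Rightarrow> 'a \<Rightarrow> 'k) \<Rightarrow> ('k, 'a) ptensor \<Rightarrow> 'k" where
  "form_lift \<equiv> tensor_lift smul scalars"

lemma form_lift:
  assumes "bounded_bilinear_map smul (*) \<phi>"
  shows "form_lift \<phi> \<in> bounded_ops (proj_tensor smul) scalars"
    and "form_lift \<phi> (tens smul a b) = \<phi> a b"
  using tensor_lift[OF banach_algebra_scalars assms] by (simp_all add: scalars_eq_alg_space)

lemma form_lift_eqI:
  assumes "T \<in> bounded_ops (proj_tensor smul) scalars" "\<And>a b. T (tens smul a b) = \<phi> a b"
  shows "T = form_lift \<phi>"
  using tensor_lift_eqI[OF assms(1) normed_space_scalars assms(2)] by simp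

text \<open>This is the relation \<open>a \<cdot> M = M \<cdot> a\<close> tested on the functional
  of \<open>\<phi>\<close>. Both actions are second adjoints, so each side is M at
  \<open>form_lift \<phi>\<close> composed with an action, and the values on elementary tensors
  identify that composition. With M read as \<open>\<Sum> b \<otimes> c\<close>, a factor on the
  left of b moves to the right of c.\<close>

lemma bidual_tensor_balanced:
  assumes M: "M \<in> bounded_ops (dual (proj_tensor smul)) scalars"
    and comm: "bidual_tensor_lact smul a M = bidual_tensor_ract smul a M"
    and \<phi>: "bounded_bilinear_map smul (*) \<phi>"
  shows "M (form_lift (\<lambda>b c. \<phi> (a * b) c)) = M (form_lift (\<lambda>b c. \<phi> b (c * a)))"
proof -
  let ?X = "proj_tensor smul"
  have "M (form_lift (\<lambda>b c. \<phi> (a * b) c)) = M (\<lambda>u\<in>vcarrier ?X. form_lift \<phi> (tensor_lact smul a u))"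
    by (rule arg_cong[where f = M, symmetric], rule form_lift_eqI)
       (simp_all add: bounded_ops_compose[OF tensor_lact(1) form_lift(1)[OF \<phi>]]
         seminormed_space_proj_tensor tens_closed tensor_lact(2) form_lift(2)[OF \<phi>])
  also have "\<dots> = bidual_tensor_lact smul a M (form_lift \<phi>)"
    by (simp add: bidual_tensor_lact_def biadjoint_op_apply M form_lift(1)[OF \<phi>])
  also have "\<dots> = M (\<lambda>u\<in>vcarrier ?X. form_lift \<phi> (tensor_ract smul a u))"
    unfolding comm by (simp add: bidual_tensor_ract_def biadjoint_op_apply M form_lift(1)[OF \<phi>])
  also have "\<dots> = M (form_lift (\<lambda>b c. \<phi> b (c * a)))"
    by (rule arg_cong[where f = M], rule form_lift_eqI)
       (simp_all add: bounded_ops_compose[OF tensor_ract(1) form_lift(1)[OF \<phi>]]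
         seminormed_space_proj_tensor tens_closed tensor_ract(2) form_lift(2)[OF \<phi>])
  finally show ?thesis .
qed

lemma alg_space_op_compose:
  assumes "S \<in> bounded_ops (alg_space smul) (alg_space smul)" "f \<in> bounded_ops (alg_space smul) Y"
  shows "(\<lambda>x. f (S x)) \<in> bounded_ops (alg_space smul) Y"
proof -
  have "seminormed_space (alg_space smul)" by (rule normed_space.axioms(1)[OF normed_space_alg_space])
  from bounded_ops_compose[OF assms this this] show ?thesis by (simp add: restrict_UNIV)
qed

lemma bounded_bilinear_mult: "bounded_bilinear_map smul smul (*)"
  using norm_mult_ineq
  by (auto simp: bounded_bilinear_map_def distrib_left distrib_right scale_mult_left scale_mult_right
      intro!: exI[of _ 1])

text \<open>Covers the two forms to which the commutation relation is applied: S is the identity or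
  \<open>b \<mapsto> P (a * b)\<close>.\<close>

lemma bounded_bilinear_form_mult:
  assumes f: "f \<in> bounded_ops (alg_space smul) scalars"
    and S: "S \<in> bounded_ops (alg_space smul) (alg_space smul)"
  shows "bounded_bilinear_map smul (*) (\<lambda>b c. f (S b * c))"
proof -
  interpret A: normed_space "alg_space smul" by (rule normed_space_alg_space)
  obtain B where B: "B \<ge> 0" "\<And>x. norm (f x) \<le> B * norm x"
    using bounded_ops_bound[OF f A.seminormed_space_axioms] by (metis UNIV_I alg_space_simps(1,4) scalars_simps(4))
  obtain C where C: "C \<ge> 0" "\<And>x. norm (S x) \<le> C * norm x"
    using bounded_ops_bound[OF S A.seminormed_space_axioms] by (metis UNIV_I alg_space_simps(1,4))
  have "norm (f (S b * c)) \<le> (B * C) * (norm b * norm c)" for b c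
  proof -
    have "norm (f (S b * c)) \<le> B * norm (S b * c)" by (rule B)
    also have "\<dots> \<le> B * ((C * norm b) * norm c)"
      by (intro mult_left_mono B order_trans[OF norm_mult_ineq] mult_right_mono C) simp
    finally show ?thesis by (simp add: mult_ac)
  qed
  moreover note bounded_opsD(2,3)[OF f, simplified] bounded_opsD(2,3)[OF S, simplified]
  ultimately show ?thesis
    unfolding bounded_bilinear_map_def
    by (auto simp: distrib_left distrib_right scale_mult_left scale_mult_right)
qed

lemma product_map:
  shows "product_map smul \<in> bounded_ops (proj_tensor smul) (alg_space smul)"
    and "product_map smul (tens smul a b) = a * b"
  unfolding product_map_def
  using tensor_lift[OF banach_algebra_axioms bounded_bilinear_mult] by simp_all

text \<open>Translates the approximation condition into values on forms: the left side is the
  product map's second adjoint at M, multiplied by a and paired with f.\<close>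

lemma bidual_product_apply:
  assumes M: "M \<in> bounded_ops (dual (proj_tensor smul)) scalars"
    and f: "f \<in> bounded_ops (alg_space smul) scalars"
  shows "bidual_alg_ract smul a (biadjoint_op (proj_tensor smul) (alg_space smul) (product_map smul) M) f =
    M (form_lift (\<lambda>b c. f (b * c * a)))"
proof -
  interpret A: normed_space "alg_space smul" by (rule normed_space_alg_space)
  note A = A.seminormed_space_axioms
  have fa: "(\<lambda>x. f (x * a)) \<in> bounded_ops (alg_space smul) scalars"
    by (rule alg_space_op_compose[OF mult_right_bounded_op f])
  have "biadjoint_op (proj_tensor smul) (alg_space smul) (product_map smul) M \<in> bounded_ops (dual (alg_space smul)) scalars"
    using bounded_opsD(1)[OF biadjoint_op_bounded[OF seminormed_space_proj_tensor A product_map(1)]] M by simp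
  then have "bidual_alg_ract smul a (biadjoint_op (proj_tensor smul) (alg_space smul) (product_map smul) M) f =
      M (\<lambda>u\<in>vcarrier (proj_tensor smul). f (product_map smul u * a))"
    using M f fa by (simp add: bidual_alg_ract_def biadjoint_op_apply restrict_UNIV)
  also have "\<dots> = M (form_lift (\<lambda>b c. f (b * c * a)))"
    by (rule arg_cong[where f = M], rule form_lift_eqI)
       (simp_all add: bounded_ops_compose[OF product_map(1) fa] A
         seminormed_space_proj_tensor tens_closed product_map(2))
  finally show ?thesis .
qed

lemma bidual_form_lift_zero:
  assumes M: "M \<in> bounded_ops (dual (proj_tensor smul)) scalars"
  shows "M (form_lift (\<lambda>_ _. 0)) = 0"
proof -
  have z: "bounded_bilinear_map smul (*) (\<lambda>_ _. 0 :: 'k)" by (auto simp: bounded_bilinear_map_def intro: exI[of _ 0])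
  \<comment> \<open>The zero functional is recognised as 0 times itself, so that homogeneity of M
    applies to it.\<close>
  have "vscale (dual (proj_tensor smul)) 0 (form_lift (\<lambda>_ _. 0)) = form_lift (\<lambda>_ _. 0)"
  proof (rule form_lift_eqI)
    show "vscale (dual (proj_tensor smul)) 0 (form_lift (\<lambda>_ _. 0)) \<in> bounded_ops (proj_tensor smul) scalars"
      unfolding dual_simps(1)[symmetric]
      by (intro seminormed_space.scale_closed seminormed_space.seminormed_dual seminormed_space_proj_tensor)
         (simp add: form_lift(1)[OF z])
  qed (simp add: tens_closed)
  then show ?thesis
    using bounded_opsD(3)[OF M, of "form_lift (\<lambda>_ _. 0)" 0] form_lift(1)[OF z] by simp
qed

end

section \<open>A fixed net of commuting elements and the functionals it annihilates\<close>

locale approximate_diagonal = banach_algebra smul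
  for smul :: "'k::{real_normed_field,euclidean_space} \<Rightarrow> 'a::{real_normed_algebra,banach} \<Rightarrow> 'a" +
  fixes I :: "'i set" and le :: "'i \<Rightarrow> 'i \<Rightarrow> bool" and m :: "'i \<Rightarrow> (('k, 'a) ptensor \<Rightarrow> 'k) \<Rightarrow> 'k"
  assumes directed: "directed_set I le"
    and bidual: "\<alpha> \<in> I \<Longrightarrow> m \<alpha> \<in> bounded_ops (dual (proj_tensor smul)) scalars"
    and commutes: "\<alpha> \<in> I \<Longrightarrow> bidual_tensor_lact smul a (m \<alpha>) = bidual_tensor_ract smul a (m \<alpha>)"
    and approximates: "((\<lambda>\<alpha>. vnorm (bidual (alg_space smul))
                (vdiff (bidual (alg_space smul))
                  (bidual_alg_ract smul a
                    (biadjoint_op (proj_tensor smul) (alg_space smul) (product_map smul) (m \<alpha>)))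
                  (canon (alg_space smul) a)))
              \<longlongrightarrow> 0) (tail_filter I le)"
begin

text \<open>Under the hypothesis the difference in \<open>approximates\<close>, paired with f, is
  \<open>- f a\<close> at every index, while its norm tends to 0. All uses of convergence go through
  this lemma, with f and a fixed.\<close>

lemma functional_eq_zero:
  assumes f: "f \<in> bounded_ops (alg_space smul) scalars"
    and zero: "\<And>\<alpha>. \<alpha> \<in> I \<Longrightarrow> m \<alpha> (form_lift (\<lambda>b c. f (b * c * a))) = 0"
  shows "f a = 0"
proof -
  interpret A: normed_space "alg_space smul" by (rule normed_space_alg_space)
  interpret D: normed_space "dual (alg_space smul)" by (rule A.normed_space_dual)
  interpret DD: seminormed_space "bidual (alg_space smul)" by (rule D.seminormed_dual)
  note A = A.seminormed_space_axioms
  define F where "F \<alpha> = bidual_alg_ract smul a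
    (biadjoint_op (proj_tensor smul) (alg_space smul) (product_map smul) (m \<alpha>))" for \<alpha>
  let ?d = "\<lambda>\<alpha>. vdiff (bidual (alg_space smul)) (F \<alpha>) (canon (alg_space smul) a)"
  let ?K = "vnorm (dual (alg_space smul)) f"
  have K: "?K \<ge> 0" using D.norm_nonneg f by simp
  have le: "norm (f a) \<le> vnorm (bidual (alg_space smul)) (?d \<alpha>) * ?K" if \<alpha>: "\<alpha> \<in> I" for \<alpha>
  proof -
    have "F \<alpha> \<in> vcarrier (bidual (alg_space smul))"
      unfolding F_def bidual_alg_ract_def
      using bidual[OF \<alpha>] product_map(1)
      by (intro bounded_opsD(1)[OF biadjoint_op_bounded] A seminormed_space_proj_tensor mult_right_bounded_op) simp_all
    then have "?d \<alpha> \<in> bounded_ops (dual (alg_space smul)) scalars"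
      using DD.diff_closed[of "F \<alpha>" "canon (alg_space smul) a"] A.canon_in_bidual[of a] by simp
    moreover have "?d \<alpha> f = - f a"
      using f zero[OF \<alpha>] bidual_product_apply[OF bidual[OF \<alpha>] f, of a]
      by (simp add: vdiff_def canon_def F_def)
    ultimately show ?thesis
      using D.norm_apply_le[of "?d \<alpha>" f] f by simp
  qed
  have "norm (f a) \<le> 0 + e" if e: "e > 0" for e
  proof -
    \<comment> \<open>The norm of f may be 0, hence the summand 1.\<close>
    have "e / (?K + 1) > 0" using e K by simp
    then have "eventually (\<lambda>\<alpha>. vnorm (bidual (alg_space smul)) (?d \<alpha>) < e / (?K + 1)) (tail_filter I le)"
      unfolding F_def by (rule order_tendstoD(2)[OF approximates])
    then obtain i where i: "i \<in> I"
      and "\<forall>\<alpha>\<in>I. le i \<alpha> \<longrightarrow> vnorm (bidual (alg_space smul)) (?d \<alpha>) < e / (?K + 1)"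
      unfolding eventually_tail_filter[OF directed] by blast
    \<comment> \<open>One index of the tail is enough, and by reflexivity its starting point
      qualifies.\<close>
    moreover have "le i i"
      using directed i unfolding directed_set_def by (elim conjE) (rule bspec)
    ultimately have \<alpha>: "i \<in> I" "vnorm (bidual (alg_space smul)) (?d i) < e / (?K + 1)"
      by blast+
    have "norm (f a) \<le> vnorm (bidual (alg_space smul)) (?d i) * ?K" by (rule le[OF \<alpha>(1)])
    also have "\<dots> \<le> (e / (?K + 1)) * ?K" using \<alpha>(2) K by (intro mult_right_mono) auto
    also have "\<dots> \<le> e" using e K by (simp add: field_simps)
    finally show ?thesis by simp
  qed
  then have "norm (f a) \<le> 0" by (rule field_le_epsilon)
  then show ?thesis by simp
qed

text \<open>
  With \<open>m = \<Sum> b \<otimes> c\<close>, and \<open>z = a * x\<close> for \<open>x \<in> N\<close>, moving factors through the commutation relation gives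
  \<open>f z \<approx> \<Sum> f (b c z) = \<Sum> f (a x b c) = \<Sum> f (P (a x b) c) = \<Sum> f (P (a b) (c x)) = 0\<close>. Hence \<open>f\<close> vanishes
  on \<open>A N\<close>, and so does \<open>f x \<approx> \<Sum> f (b (c x))\<close>.
\<close>

lemma functional_vanishes_on_ideal:
  assumes f: "f \<in> bounded_ops (alg_space smul) scalars"
    and ideal: "\<And>a x. x \<in> N \<Longrightarrow> a * x \<in> N" "\<And>a x. x \<in> N \<Longrightarrow> x * a \<in> N"
    and P: "P \<in> bounded_ops (alg_space smul) (alg_space smul)" "\<And>a. P a \<in> N" "\<And>x. x \<in> N \<Longrightarrow> P x = x"
    and fNN: "\<And>y z. y \<in> N \<Longrightarrow> z \<in> N \<Longrightarrow> f (y * z) = 0"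
    and x: "x \<in> N"
  shows "f x = 0"
proof -
  have AN: "f (a * y) = 0" if y: "y \<in> N" for a y
  proof (rule functional_eq_zero[OF f])
    fix \<alpha> assume \<alpha>: "\<alpha> \<in> I"
    note balanced = bidual_tensor_balanced[OF bidual[OF \<alpha>] commutes[OF \<alpha>]]
    have "(\<lambda>b. P (a * b)) \<in> bounded_ops (alg_space smul) (alg_space smul)"
      by (rule alg_space_op_compose[OF mult_left_bounded_op P(1)])
    then have \<phi>: "bounded_bilinear_map smul (*) (\<lambda>b c. f (P (a * b) * c))"
      by (rule bounded_bilinear_form_mult[OF f])
    have "m \<alpha> (form_lift (\<lambda>b c. f (b * c * (a * y)))) = m \<alpha> (form_lift (\<lambda>b c. f (b * (c * (a * y)))))"
      by (simp add: mult.assoc)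
    also have "\<dots> = m \<alpha> (form_lift (\<lambda>b c. f ((a * y) * b * c)))"
      using balanced[OF bounded_bilinear_form_mult[OF f id_bounded_op], of "a * y"] by simp
    \<comment> \<open>The ideal property puts \<open>a * y * b\<close> into N, where P is the
      identity, so P can be inserted.\<close>
    also have "(\<lambda>b c. f ((a * y) * b * c)) = (\<lambda>b c. f (P (a * (y * b)) * c))"
      by (simp add: P(3) ideal y mult.assoc)
    \<comment> \<open>Only y moves, while a stays inside the form. Afterwards both factors
      \<open>P (a * b)\<close> and \<open>c * y\<close> lie in N, and f vanishes on their
      product.\<close>
    also have "m \<alpha> (form_lift \<dots>) = m \<alpha> (form_lift (\<lambda>b c. f (P (a * b) * (c * y))))"
      by (rule balanced[OF \<phi>])
    also have "\<dots> = m \<alpha> (form_lift (\<lambda>_ _. 0))"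
      by (simp add: fNN P(2) ideal y)
    finally show "m \<alpha> (form_lift (\<lambda>b c. f (b * c * (a * y)))) = 0"
      by (simp add: bidual_form_lift_zero[OF bidual[OF \<alpha>]])
  qed
  show ?thesis
  proof (rule functional_eq_zero[OF f])
    fix \<alpha> assume "\<alpha> \<in> I"
    then show "m \<alpha> (form_lift (\<lambda>b c. f (b * c * x))) = 0"
      by (simp add: AN x bidual_form_lift_zero[OF bidual])
  qed
qed

text \<open>Here n counts the factors after the first, so n = 0 says that N is trivial. If a product
  \<open>w * z\<close> of n + 1 factors were nonzero, a functional f separating it from 0 would give
  \<open>x \<mapsto> f (w * x)\<close>, which kills N N because \<open>w * (u * v)\<close> has n + 2
  factors, and hence kills z.\<close>

lemma nilpotent_complemented_ideal_trivial:
  assumes ideal: "\<And>a x. x \<in> N \<Longrightarrow> a * x \<in> N" "\<And>a x. x \<in> N \<Longrightarrow> x * a \<in> N"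
    and P: "P \<in> bounded_ops (alg_space smul) (alg_space smul)" "\<And>a. P a \<in> N" "\<And>x. x \<in> N \<Longrightarrow> P x = x"
    and nilpotent: "\<And>x xs. set (x # xs) \<subseteq> N \<Longrightarrow> length xs = n \<Longrightarrow> foldl (*) x xs = 0"
    and x: "x \<in> N"
  shows "x = 0"
  using nilpotent
proof (induction n)
  case 0
  show ?case using 0[of x "[]"] x by simp
next
  case (Suc n)
  have separate: "\<exists>f\<in>bounded_ops (alg_space smul) scalars. f v \<noteq> 0" if v: "v \<noteq> 0" for v
  proof -
    obtain f B where "Vector_Spaces.linear smul (*) f" "\<And>x. norm (f x) \<le> B * norm x" "f v \<noteq> 0"
      using separating_functional[OF v] by blast
    then show ?thesis
      by (intro bexI[of _ f] bounded_opsI[where B = B]) (simp_all add: linear_form_iff)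
  qed
  have zero: "f 0 = 0" if "f \<in> bounded_ops (alg_space smul) scalars" for f
    using bounded_opsD(3)[OF that, of 0 0] by simp
  have vanish: "f x = 0" if "f \<in> bounded_ops (alg_space smul) scalars"
    "\<And>u v. u \<in> N \<Longrightarrow> v \<in> N \<Longrightarrow> f (u * v) = 0" "x \<in> N" for f x
    by (rule functional_vanishes_on_ideal[where N = N and P = P]) (fact that ideal P)+
  have "foldl (*) y ys = 0" if ys: "set (y # ys) \<subseteq> N" "length ys = n" for y ys
  proof (rule ccontr)
    assume "foldl (*) y ys \<noteq> 0"
    then obtain f where f: "f \<in> bounded_ops (alg_space smul) scalars" "f (foldl (*) y ys) \<noteq> 0"
      using separate by blast
    show False
    \<comment> \<open>With a single factor there is no prefix w, and the algebra may have no unit to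
      stand in for it, so f itself is used.\<close>
    proof (cases ys rule: rev_cases)
      case Nil
      have NN: "f (u * v) = 0" if "u \<in> N" "v \<in> N" for u v
        using Suc.prems[of u "[v]"] that ys(2) Nil zero[OF f(1)] by simp
      have "f y = 0" by (rule vanish[OF f(1)], fact NN) (use ys(1) in simp)
      then show False using f(2) Nil by simp
    next
      case (snoc zs z)
      define w where "w = foldl (*) y zs"
      have fw: "(\<lambda>x. f (w * x)) \<in> bounded_ops (alg_space smul) scalars"
        by (rule alg_space_op_compose[OF mult_left_bounded_op f(1)])
      \<comment> \<open>Replacing the last factor z by the pair u, v lengthens the product by
        exactly one.\<close>
      have NN: "f (w * (u * v)) = 0" if "u \<in> N" "v \<in> N" for u v
        using Suc.prems[of y "zs @ [u, v]"] that ys snoc zero[OF f(1)] by (simp add: w_def mult.assoc)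
      have "f (w * z) = 0" by (rule vanish[OF fw], fact NN) (use ys(1) snoc in simp)
      then show False using f(2) snoc by (simp add: w_def)
    qed
  qed
  then show ?case by (rule Suc.IH)
qed

end

theorem theorem4p3:
  fixes smul :: "'k::{real_normed_field,euclidean_space} \<Rightarrow> 'a::{real_normed_algebra,banach} \<Rightarrow> 'a"
  assumes "banach_algebra smul"
    and "johnson_pseudo_contractible TYPE('i) smul"
  shows "\<not> (\<exists>N. two_sided_ideal smul N \<and> N \<noteq> {0} \<and> closed N \<and> nilpotent_ideal N \<and>
    complemented (alg_space smul) N)"
proof
  interpret banach_algebra smul by (rule assms(1))
  assume "\<exists>N. two_sided_ideal smul N \<and> N \<noteq> {0} \<and> closed N \<and> nilpotent_ideal N \<and>
    complemented (alg_space smul) N"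
  then obtain N where N: "two_sided_ideal smul N" "N \<noteq> {0}" "nilpotent_ideal N"
    "complemented (alg_space smul) N" by blast
  obtain I :: "'i set" and le m where "directed_set I le"
    and "\<forall>\<alpha>\<in>I. m \<alpha> \<in> vcarrier (bidual (proj_tensor smul))"
    and "\<forall>a. \<forall>\<alpha>\<in>I. bidual_tensor_lact smul a (m \<alpha>) = bidual_tensor_ract smul a (m \<alpha>)"
    and "\<forall>a. ((\<lambda>\<alpha>. vnorm (bidual (alg_space smul))
                (vdiff (bidual (alg_space smul))
                  (bidual_alg_ract smul a
                    (biadjoint_op (proj_tensor smul) (alg_space smul) (product_map smul) (m \<alpha>)))
                  (canon (alg_space smul) a)))
              \<longlongrightarrow> 0) (tail_filter I le)"
    using assms(2) unfolding johnson_pseudo_contractible_def by (elim exE conjE)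
  then interpret approximate_diagonal smul I le m
    by unfold_locales simp_all
  obtain P where P: "P \<in> bounded_ops (alg_space smul) ((alg_space smul)\<lparr>vcarrier := N\<rparr>)"
    and PN: "\<And>x. x \<in> N \<Longrightarrow> P x = x"
    using N(4) unfolding complemented_def by blast
  \<comment> \<open>Only the carrier of the codomain differs, so P is also an operator into the
    whole algebra, with range in N.\<close>
  have "P \<in> bounded_ops (alg_space smul) (alg_space smul)" "\<And>a. P a \<in> N"
    using P by (auto simp: bounded_ops_def alg_space_def PiE_def)
  note P = this PN
  have ideal: "\<And>a x. x \<in> N \<Longrightarrow> a * x \<in> N" "\<And>a x. x \<in> N \<Longrightarrow> x * a \<in> N" and "0 \<in> N"
    using N(1) subspace_0 by (auto simp: two_sided_ideal_def)
  obtain n where n: "n \<ge> 1"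
    and "\<And>x xs. set (x # xs) \<subseteq> N \<Longrightarrow> length (x # xs) = n \<Longrightarrow> foldl (*) x xs = 0"
    using N(3) unfolding nilpotent_ideal_def by blast
  \<comment> \<open>\<open>nilpotent_ideal\<close> counts all factors, the preceding lemma those
    after the first; n \<ge> 1 makes the subtraction exact.\<close>
  then have nilpotent: "foldl (*) x xs = 0" if "set (x # xs) \<subseteq> N" "length xs = n - 1" for x xs
    using that n by simp
  have "x = 0" if "x \<in> N" for x
    by (rule nilpotent_complemented_ideal_trivial[OF ideal P nilpotent that])
  then show False using N(2) \<open>0 \<in> N\<close> by blast
qed

end
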